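(* Let $p>3$ be a prime. Then $$M=\{(\alpha,\beta,0)\mid\alpha,\beta=1,2,\dots,p-1\}\cup\{(\alpha,1-\alpha,1)\mid\alpha=2,\dots,p-1\}$$ is the set of all pairwise non-isomorphic linear group isotopes of order $p$ (i.e. every linear group isotope of order $p$ is isomorphic to exactly one element of $M$). The set $M$ is the union of the following disjoint sets: 1) the set of all strictly commutative group isotopes in $M$: $M^{cs}=\{(1,1,0),(2,2,0),\ldots,(p-2,p-2,0),(2^{-1},2^{-1},1)\}$; 2) the set of all strictly left symmetric group isotopes in $M$: $M^{ls}=\{(1,p-1,0),(2,p-1,0),\ldots,(p-2,p-1,0),(2,p-1,1)\}$; 3) the set of all strictly right symmetric group isotopes in $M$: $M^{rs}=\{(p-1,1,0),(p-1,2,0),\ldots,(p-1,p-2,0),(p-1,2,1)\}$; 4) the set of all totally symmetric group isotopes in $M$: $M^{ts}=\{(p-1,p-1,0)\}$; 5) the set $M^{ss}$ of all strictly semi-symmetric group isotopes in $M$, which is empty if $p-3$ is not a quadratic residue modulo $p$, and which, if there is $k$ with $p-3\equiv k^2\pmod p$, equals $$M^{ss}=\left\{\left((1+k)2^{-1},\,2(1+k)^{-1},\,0\right),\ \left((1-k)2^{-1},\,2(1-k)^{-1},\,0\right)\right\};$$ 6) the set of all asymmetric group isotopes in $M$: $$M^{as}=\Big(\{(\alpha,1-\alpha,1)\mid \alpha=3,\ldots,p-2\}\setminus\{(2^{-1},1-2^{-1},1)\}\Big)\cup\Big(\{(\alpha,\beta,0)\mid\alpha,\beta=1,2,\dots,p-2,\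 \alpha\neq\beta\}\setminus M^{ss}\Big).$$
   Context: For $\alpha,\beta\in\mathbb{Z}_p^{*}$ and $d\in\mathbb{Z}_p$, the triple $(\alpha,\beta,d)$ denotes the quasigroup $(\mathbb{Z}_p;\circ)$ with $x\circ y=\alpha x+\beta y+d$; all arithmetic, including inverses, is in the field $\mathbb{Z}_p$. A linear group isotope is a quasigroup $(Q;\cdot)$ of the form $x\cdot y=\varphi x+c+\psi y$ with $(Q;+)$ a group, $\varphi,\psi$ automorphisms of it and $c\in Q$. For $\sigma\in S_3$, the $\sigma$-parastrophe of a quasigroup operation $(\cdot)$ is defined by $x_{1\sigma}\stackrel{\sigma}{\cdot}x_{2\sigma}=x_{3\sigma}\Leftrightarrow x_1\cdot x_2=x_3$, and $\mathrm{Sym}(\cdot)=\{\sigma\in S_3:(\stackrel{\sigma}{\cdot})=(\cdot)\}$. A quasigroup is commutative if it satisfies $xy=yx$; left symmetric if $x\cdot xy=y$; right symmetric if $xy\cdot y=x$; semi-symmetric if $x\cdot yx=y$ (equivalently $\mathrm{Sym}(\cdot)\supseteq A_3$); totally symmetric if $xy=yx$ and $xy\cdot y=x$ (equivalently $\mathrm{Sym}(\cdot)=S_3$); asymmetric if $\mathrm{Sym}(\cdot)=\{\iota\}$. "Strictly" means: has the property but is not totally symmetric. *)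

theory Defs
  imports "HOL-Number_Theory.Number_Theory" "HOL-Combinatorics.Permutations" "HOL-Library.Disjoint_Sets"
begin

record 'a magma = "'a partial_object" +
  qmult :: "'a \<Rightarrow> 'a \<Rightarrow> 'a"  (infixl \<open>\<cdot>\<index>\<close> 70)

definition quasigroup :: "('a, 'm) magma_scheme \<Rightarrow> bool" where
  "quasigroup Q \<longleftrightarrow>
     (\<forall>x\<in>carrier Q. \<forall>y\<in>carrier Q. x \<cdot>\<^bsub>Q\<^esub> y \<in> carrier Q) \<and>
     (\<forall>a\<in>carrier Q. \<forall>b\<in>carrier Q. \<exists>!x. x \<in> carrier Q \<and> a \<cdot>\<^bsub>Q\<^esub> x = b) \<and>
     (\<forall>a\<in>carrier Q. \<forall>b\<in>carrier Q. \<exists>!y. y \<in> carrier Q \<and> y \<cdot>\<^bsub>Q\<^esub> a = b)"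

definition magma_isomorphic :: "('a, 'm) magma_scheme \<Rightarrow> ('b, 'n) magma_scheme \<Rightarrow> bool" where
  "magma_isomorphic Q R \<longleftrightarrow>
     (\<exists>h. bij_betw h (carrier Q) (carrier R) \<and>
          (\<forall>x\<in>carrier Q. \<forall>y\<in>carrier Q. h (x \<cdot>\<^bsub>Q\<^esub> y) = h x \<cdot>\<^bsub>R\<^esub> h y))"

text \<open>The group is written multiplicatively below and is not assumed to be commutative.\<close>

definition linear_group_isotope :: "('a, 'm) magma_scheme \<Rightarrow> bool" where
  "linear_group_isotope Q \<longleftrightarrow>
     quasigroup Q \<and>
     (\<exists>G :: 'a monoid. group G \<and> carrier G = carrier Q \<and>
        (\<exists>\<phi>\<in>iso G G. \<exists>\<psi>\<in>iso G G. \<exists>c\<in>carrier Q.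
           \<forall>x\<in>carrier Q. \<forall>y\<in>carrier Q.
             x \<cdot>\<^bsub>Q\<^esub> y = \<phi> x \<otimes>\<^bsub>G\<^esub> c \<otimes>\<^bsub>G\<^esub> \<psi> y))"

text \<open>
  A permutation \<open>\<sigma>\<close> of \<open>{1, 2, 3}\<close> sends the triples \<open>(x 1, x 2, x 3)\<close> with
  \<open>x 1 \<cdot> x 2 = x 3\<close> to the triples \<open>(x (\<sigma> 1), x (\<sigma> 2), x (\<sigma> 3))\<close>, which form the graph of
  the \<open>\<sigma>\<close>-parastrophe. In a quasigroup the described element exists and is unique.
\<close>

definition parastrophe :: "('a, 'm) magma_scheme \<Rightarrow> (nat \<Rightarrow> nat) \<Rightarrow> 'a \<Rightarrow> 'a \<Rightarrow> 'a" where
  "parastrophe Q \<sigma> a b =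
     (THE c. \<exists>x :: nat \<Rightarrow> 'a. (\<forall>i\<in>{1, 2, 3}. x i \<in> carrier Q) \<and>
        x (\<sigma> 1) = a \<and> x (\<sigma> 2) = b \<and> x (\<sigma> 3) = c \<and> x 1 \<cdot>\<^bsub>Q\<^esub> x 2 = x 3)"

definition Sym :: "('a, 'm) magma_scheme \<Rightarrow> (nat \<Rightarrow> nat) set" where
  "Sym Q = {\<sigma>. \<sigma> permutes {1, 2, 3} \<and>
     (\<forall>a\<in>carrier Q. \<forall>b\<in>carrier Q. parastrophe Q \<sigma> a b = a \<cdot>\<^bsub>Q\<^esub> b)}"

definition asymmetric :: "('a, 'm) magma_scheme \<Rightarrow> bool" where
  "asymmetric Q \<longleftrightarrow> Sym Q = {id}"

definition commutative :: "('a, 'm) magma_scheme \<Rightarrow> bool" where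
  "commutative Q \<longleftrightarrow>
     (\<forall>x\<in>carrier Q. \<forall>y\<in>carrier Q. x \<cdot>\<^bsub>Q\<^esub> y = y \<cdot>\<^bsub>Q\<^esub> x)"

definition left_symmetric :: "('a, 'm) magma_scheme \<Rightarrow> bool" where
  "left_symmetric Q \<longleftrightarrow>
     (\<forall>x\<in>carrier Q. \<forall>y\<in>carrier Q. x \<cdot>\<^bsub>Q\<^esub> (x \<cdot>\<^bsub>Q\<^esub> y) = y)"

definition right_symmetric :: "('a, 'm) magma_scheme \<Rightarrow> bool" where
  "right_symmetric Q \<longleftrightarrow>
     (\<forall>x\<in>carrier Q. \<forall>y\<in>carrier Q. (x \<cdot>\<^bsub>Q\<^esub> y) \<cdot>\<^bsub>Q\<^esub> y = x)"

definition semi_symmetric :: "('a, 'm) magma_scheme \<Rightarrow> bool" where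
  "semi_symmetric Q \<longleftrightarrow>
     (\<forall>x\<in>carrier Q. \<forall>y\<in>carrier Q. x \<cdot>\<^bsub>Q\<^esub> (y \<cdot>\<^bsub>Q\<^esub> x) = y)"

definition totally_symmetric :: "('a, 'm) magma_scheme \<Rightarrow> bool" where
  "totally_symmetric Q \<longleftrightarrow>
     (\<forall>x\<in>carrier Q. \<forall>y\<in>carrier Q.
        x \<cdot>\<^bsub>Q\<^esub> y = y \<cdot>\<^bsub>Q\<^esub> x \<and> (x \<cdot>\<^bsub>Q\<^esub> y) \<cdot>\<^bsub>Q\<^esub> y = x)"

definition strictly :: "(('a, 'm) magma_scheme \<Rightarrow> bool) \<Rightarrow> ('a, 'm) magma_scheme \<Rightarrow> bool" where
  "strictly P Q \<longleftrightarrow> P Q \<and> \<not> totally_symmetric Q"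

text \<open>Elements of \<open>Zmod p\<close> are the integers \<open>0, \<dots>, p - 1\<close>.\<close>

abbreviation Zmod :: "nat \<Rightarrow> int ring" where
  "Zmod p \<equiv> residue_ring (int p)"

type_synonym triple = "int \<times> int \<times> int"

definition isotope :: "nat \<Rightarrow> triple \<Rightarrow> int magma" where
  "isotope p = (\<lambda>(\<alpha>, \<beta>, d).
     \<lparr> carrier = carrier (Zmod p),
       qmult = (\<lambda>x y. \<alpha> \<otimes>\<^bsub>Zmod p\<^esub> x \<oplus>\<^bsub>Zmod p\<^esub> \<beta> \<otimes>\<^bsub>Zmod p\<^esub> y \<oplus>\<^bsub>Zmod p\<^esub> d) \<rparr>)"

definition M :: "nat \<Rightarrow> triple set" where
  "M p = {(\<alpha>, \<beta>, 0) | \<alpha> \<beta>. \<alpha> \<in> {1..int p - 1} \<and> \<beta> \<in> {1..int p - 1}} \<union>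
         {(\<alpha>, 1 \<ominus>\<^bsub>Zmod p\<^esub> \<alpha>, 1) | \<alpha>. \<alpha> \<in> {2..int p - 1}}"

definition M_cs :: "nat \<Rightarrow> triple set" where
  "M_cs p = {t \<in> M p. strictly commutative (isotope p t)}"

definition M_ls :: "nat \<Rightarrow> triple set" where
  "M_ls p = {t \<in> M p. strictly left_symmetric (isotope p t)}"

definition M_rs :: "nat \<Rightarrow> triple set" where
  "M_rs p = {t \<in> M p. strictly right_symmetric (isotope p t)}"

definition M_ts :: "nat \<Rightarrow> triple set" where
  "M_ts p = {t \<in> M p. totally_symmetric (isotope p t)}"

definition M_ss :: "nat \<Rightarrow> triple set" where
  "M_ss p = {t \<in> M p. strictly semi_symmetric (isotope p t)}"

definition M_as :: "nat \<Rightarrow> triple set" where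
  "M_as p = {t \<in> M p. asymmetric (isotope p t)}"

end

theory Submission
  imports Defs
begin

text \<open>
  A group of prime order is cyclic, so a linear group isotope of order \<open>p\<close> is isomorphic to some
  \<open>(\<alpha>, \<beta>, d)\<close>. An affine substitution normalises \<open>d\<close>: to \<open>0\<close> by moving the idempotent to the origin
  if \<open>\<alpha> + \<beta> \<noteq> 1\<close>, and to \<open>0\<close> or \<open>1\<close> by scaling if \<open>\<alpha> + \<beta> = 1\<close>. Conversely every isomorphism between
  two such quasigroups is affine, so \<open>\<alpha>\<close> and \<open>\<beta>\<close> are invariants, and in the case \<open>\<alpha> + \<beta> = 1\<close> the
  existence of an idempotent separates \<open>d = 0\<close> from \<open>d = 1\<close>. Each parastrophic symmetry is a
  polynomial condition on \<open>\<alpha>\<close>, \<open>\<beta>\<close>, \<open>d\<close>; a transposition in \<open>Sym\<close> corresponds to commutativity or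
  left or right symmetry, and either 3-cycle to semi-symmetry.
\<close>

section \<open>Quasigroup identities and parastrophic symmetries\<close>

lemma quasigroup_closed:
  "\<lbrakk>quasigroup Q; x \<in> carrier Q; y \<in> carrier Q\<rbrakk> \<Longrightarrow> x \<cdot>\<^bsub>Q\<^esub> y \<in> carrier Q"
  by (simp add: quasigroup_def)

lemma quasigroup_cancel_left:
  assumes "quasigroup Q" "a \<in> carrier Q" "x \<in> carrier Q" "y \<in> carrier Q"
    and eq: "a \<cdot>\<^bsub>Q\<^esub> x = a \<cdot>\<^bsub>Q\<^esub> y"
  shows "x = y"
proof -
  have "\<exists>!z. z \<in> carrier Q \<and> a \<cdot>\<^bsub>Q\<^esub> z = a \<cdot>\<^bsub>Q\<^esub> y"
    using assms by (simp add: quasigroup_def)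
  then show ?thesis using assms by blast
qed

lemma quasigroup_cancel_right:
  assumes "quasigroup Q" "a \<in> carrier Q" "x \<in> carrier Q" "y \<in> carrier Q"
    and eq: "x \<cdot>\<^bsub>Q\<^esub> a = y \<cdot>\<^bsub>Q\<^esub> a"
  shows "x = y"
proof -
  have "\<exists>!z. z \<in> carrier Q \<and> z \<cdot>\<^bsub>Q\<^esub> a = y \<cdot>\<^bsub>Q\<^esub> a"
    using assms by (simp add: quasigroup_def)
  then show ?thesis using assms by blast
qed

text \<open>Applying either identity to \<open>x\<close> and a product of \<open>x\<close> and
  \<open>y\<close>, then cancelling \<open>x\<close>, yields the other. The two forms arise from the
  two 3-cycles.\<close>

lemma quasigroup_semi_symmetric_iff:
  assumes Q: "quasigroup Q"
  shows "semi_symmetric Q \<longleftrightarrow>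
    (\<forall>x\<in>carrier Q. \<forall>y\<in>carrier Q. (x \<cdot>\<^bsub>Q\<^esub> y) \<cdot>\<^bsub>Q\<^esub> x = y)"
proof
  assume S: "semi_symmetric Q"
  show "\<forall>x\<in>carrier Q. \<forall>y\<in>carrier Q. (x \<cdot>\<^bsub>Q\<^esub> y) \<cdot>\<^bsub>Q\<^esub> x = y"
  proof (intro ballI)
    fix x y assume xy: "x \<in> carrier Q" "y \<in> carrier Q"
    then have c: "x \<cdot>\<^bsub>Q\<^esub> y \<in> carrier Q" "(x \<cdot>\<^bsub>Q\<^esub> y) \<cdot>\<^bsub>Q\<^esub> x \<in> carrier Q"
      by (simp_all add: quasigroup_closed[OF Q])
    from S xy c have "x \<cdot>\<^bsub>Q\<^esub> ((x \<cdot>\<^bsub>Q\<^esub> y) \<cdot>\<^bsub>Q\<^esub> x) = x \<cdot>\<^bsub>Q\<^esub> y"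
      unfolding semi_symmetric_def by simp
    then show "(x \<cdot>\<^bsub>Q\<^esub> y) \<cdot>\<^bsub>Q\<^esub> x = y"
      by (rule quasigroup_cancel_left[OF Q xy(1) c(2) xy(2)])
  qed
next
  assume S: "\<forall>x\<in>carrier Q. \<forall>y\<in>carrier Q. (x \<cdot>\<^bsub>Q\<^esub> y) \<cdot>\<^bsub>Q\<^esub> x = y"
  show "semi_symmetric Q"
    unfolding semi_symmetric_def
  proof (intro ballI)
    fix x y assume xy: "x \<in> carrier Q" "y \<in> carrier Q"
    then have c: "y \<cdot>\<^bsub>Q\<^esub> x \<in> carrier Q" "x \<cdot>\<^bsub>Q\<^esub> (y \<cdot>\<^bsub>Q\<^esub> x) \<in> carrier Q"
      by (simp_all add: quasigroup_closed[OF Q])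
    from S xy c have "(x \<cdot>\<^bsub>Q\<^esub> (y \<cdot>\<^bsub>Q\<^esub> x)) \<cdot>\<^bsub>Q\<^esub> x = y \<cdot>\<^bsub>Q\<^esub> x"
      by simp
    then show "x \<cdot>\<^bsub>Q\<^esub> (y \<cdot>\<^bsub>Q\<^esub> x) = y"
      by (rule quasigroup_cancel_right[OF Q xy(1) c(2) xy(2)])
  qed
qed

text \<open>Only the first case is an equality of functions, because asymmetry compares with
  \<open>id\<close>; for the other five the values at 1, 2, 3 are enough.\<close>

lemma permutes_123_cases:
  assumes "\<sigma> permutes {1, 2, 3 :: nat}"
  obtains "\<sigma> = id"
  | "\<sigma> 1 = 2" "\<sigma> 2 = 1" "\<sigma> 3 = 3" | "\<sigma> 1 = 1" "\<sigma> 2 = 3" "\<sigma> 3 = 2"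
  | "\<sigma> 1 = 3" "\<sigma> 2 = 2" "\<sigma> 3 = 1" | "\<sigma> 1 = 2" "\<sigma> 2 = 3" "\<sigma> 3 = 1"
  | "\<sigma> 1 = 3" "\<sigma> 2 = 1" "\<sigma> 3 = 2"
proof -
  have range: "\<sigma> 1 \<in> {1, 2, 3}" "\<sigma> 2 \<in> {1, 2, 3}" "\<sigma> 3 \<in> {1, 2, 3}"
    using permutes_in_image[OF assms] by blast+
  have "inj \<sigma>" by (rule permutes_inj[OF assms])
  then have dist: "\<sigma> 1 \<noteq> \<sigma> 2" "\<sigma> 1 \<noteq> \<sigma> 3" "\<sigma> 2 \<noteq> \<sigma> 3" by (simp_all add: inj_eq)
  have "\<sigma> = id" if "\<sigma> 1 = 1" "\<sigma> 2 = 2" "\<sigma> 3 = 3"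
  proof
    fix x show "\<sigma> x = id x"
      using that permutes_not_in[OF assms, of x] by (cases "x \<in> {1, 2, 3}") auto
  qed
  moreover have "\<sigma> 1 = 1 \<and> \<sigma> 2 = 2 \<and> \<sigma> 3 = 3 \<or> \<sigma> 1 = 2 \<and> \<sigma> 2 = 1 \<and> \<sigma> 3 = 3 \<or>
      \<sigma> 1 = 1 \<and> \<sigma> 2 = 3 \<and> \<sigma> 3 = 2 \<or> \<sigma> 1 = 3 \<and> \<sigma> 2 = 2 \<and> \<sigma> 3 = 1 \<or>
      \<sigma> 1 = 2 \<and> \<sigma> 2 = 3 \<and> \<sigma> 3 = 1 \<or> \<sigma> 1 = 3 \<and> \<sigma> 2 = 1 \<and> \<sigma> 3 = 2"
    using range dist by (elim insertE emptyE) simp_all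
  ultimately show thesis using that by blast
qed

text \<open>As \<sigma> maps {1, 2, 3} onto itself, the triple \<open>x\<close> is determined by
  \<open>a\<close>, \<open>b\<close>, \<open>c\<close>. Writing it as \<open>f c\<close> removes the
  quantifier over functions, and for concrete values of \<sigma> the conditionals evaluate.\<close>

lemma parastrophe_eq_The:
  assumes \<sigma>: "\<sigma> permutes {1, 2, 3 :: nat}" and ab: "a \<in> carrier Q" "b \<in> carrier Q"
  defines "f \<equiv> \<lambda>c i. if i = \<sigma> 1 then a else if i = \<sigma> 2 then b else c"
  shows "parastrophe Q \<sigma> a b = (THE c. c \<in> carrier Q \<and> f c 1 \<cdot>\<^bsub>Q\<^esub> f c 2 = f c 3)"
proof -
  have "inj \<sigma>" by (rule permutes_inj[OF \<sigma>])
  then have dist: "\<sigma> 1 \<noteq> \<sigma> 2" "\<sigma> 1 \<noteq> \<sigma> 3" "\<sigma> 2 \<noteq> \<sigma> 3" by (simp_all add: inj_eq)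
  have range: "\<sigma> 3 \<in> {1, 2, 3}" and im: "\<sigma> ` {1, 2, 3} = {1, 2, 3}"
    using permutes_in_image[OF \<sigma>] permutes_image[OF \<sigma>] by blast+
  have "(\<exists>x. (\<forall>i\<in>{1, 2, 3}. x i \<in> carrier Q) \<and> x (\<sigma> 1) = a \<and> x (\<sigma> 2) = b \<and> x (\<sigma> 3) = c \<and>
      x 1 \<cdot>\<^bsub>Q\<^esub> x 2 = x 3) \<longleftrightarrow> c \<in> carrier Q \<and> f c 1 \<cdot>\<^bsub>Q\<^esub> f c 2 = f c 3" for c
  proof
    assume "c \<in> carrier Q \<and> f c 1 \<cdot>\<^bsub>Q\<^esub> f c 2 = f c 3"
    moreover have "f c (\<sigma> 1) = a" "f c (\<sigma> 2) = b" "f c (\<sigma> 3) = c"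
      using dist by (simp_all add: f_def)
    ultimately show "\<exists>x. (\<forall>i\<in>{1, 2, 3}. x i \<in> carrier Q) \<and> x (\<sigma> 1) = a \<and> x (\<sigma> 2) = b \<and>
      x (\<sigma> 3) = c \<and> x 1 \<cdot>\<^bsub>Q\<^esub> x 2 = x 3"
      using ab by (intro exI[of _ "f c"] conjI ballI) (simp_all add: f_def)
  next
    assume "\<exists>x. (\<forall>i\<in>{1, 2, 3}. x i \<in> carrier Q) \<and> x (\<sigma> 1) = a \<and> x (\<sigma> 2) = b \<and>
      x (\<sigma> 3) = c \<and> x 1 \<cdot>\<^bsub>Q\<^esub> x 2 = x 3"
    then obtain x where x: "\<forall>i\<in>{1, 2, 3}. x i \<in> carrier Q" "x (\<sigma> 1) = a" "x (\<sigma> 2) = b"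
      "x (\<sigma> 3) = c" "x 1 \<cdot>\<^bsub>Q\<^esub> x 2 = x 3" by blast
    have "x i = f c i" if "i \<in> {1, 2, 3}" for i
    proof -
      from that im consider "i = \<sigma> 1" | "i = \<sigma> 2" | "i = \<sigma> 3" by blast
      then show ?thesis using x dist by cases (simp_all add: f_def)
    qed
    then have "x 1 = f c 1" "x 2 = f c 2" "x 3 = f c 3" by blast+
    moreover have "c \<in> carrier Q" using x(1,4) range by blast
    ultimately show "c \<in> carrier Q \<and> f c 1 \<cdot>\<^bsub>Q\<^esub> f c 2 = f c 3"
      using x(5) by metis
  qed
  then show ?thesis by (simp add: parastrophe_def)
qed

text \<open>The unknown \<open>c\<close> is the product, the second factor or the first factor
  according to whether \<sigma> 3 is 3, 2 or 1. Unique solvability then turns each parastrophe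
  equation into an identity.\<close>

lemma Sym_iff:
  assumes Q: "quasigroup Q" and \<sigma>: "\<sigma> permutes {1, 2, 3}"
  shows "\<sigma> 1 = 2 \<Longrightarrow> \<sigma> 2 = 1 \<Longrightarrow> \<sigma> 3 = 3 \<Longrightarrow> \<sigma> \<in> Sym Q \<longleftrightarrow> commutative Q"
    and "\<sigma> 1 = 1 \<Longrightarrow> \<sigma> 2 = 3 \<Longrightarrow> \<sigma> 3 = 2 \<Longrightarrow> \<sigma> \<in> Sym Q \<longleftrightarrow> left_symmetric Q"
    and "\<sigma> 1 = 3 \<Longrightarrow> \<sigma> 2 = 2 \<Longrightarrow> \<sigma> 3 = 1 \<Longrightarrow> \<sigma> \<in> Sym Q \<longleftrightarrow> right_symmetric Q"
    and "\<sigma> 1 = 2 \<Longrightarrow> \<sigma> 2 = 3 \<Longrightarrow> \<sigma> 3 = 1 \<Longrightarrow> \<sigma> \<in> Sym Q \<longleftrightarrow> semi_symmetric Q"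
    and "\<sigma> 1 = 3 \<Longrightarrow> \<sigma> 2 = 1 \<Longrightarrow> \<sigma> 3 = 2 \<Longrightarrow> \<sigma> \<in> Sym Q \<longleftrightarrow> semi_symmetric Q"
    and "\<sigma> 1 = 1 \<Longrightarrow> \<sigma> 2 = 2 \<Longrightarrow> \<sigma> 3 = 3 \<Longrightarrow> \<sigma> \<in> Sym Q"
proof -
  have closed: "x \<cdot>\<^bsub>Q\<^esub> y \<in> carrier Q" if "x \<in> carrier Q" "y \<in> carrier Q" for x y
    using quasigroup_closed[OF Q] that .
  have left: "\<exists>!x. x \<in> carrier Q \<and> a \<cdot>\<^bsub>Q\<^esub> x = b"
    and right: "\<exists>!x. x \<in> carrier Q \<and> x \<cdot>\<^bsub>Q\<^esub> a = b"
    if "a \<in> carrier Q" "b \<in> carrier Q" for a b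
    using Q that unfolding quasigroup_def by simp_all
  have the_left: "(THE c. c \<in> carrier Q \<and> a \<cdot>\<^bsub>Q\<^esub> c = b) = d \<longleftrightarrow> a \<cdot>\<^bsub>Q\<^esub> d = b"
    if "a \<in> carrier Q" "b \<in> carrier Q" "d \<in> carrier Q" for a b d
    using theI'[OF left[OF that(1,2)]] the1_equality[OF left[OF that(1,2)], of d] that(3) by blast
  have the_right: "(THE c. c \<in> carrier Q \<and> c \<cdot>\<^bsub>Q\<^esub> a = b) = d \<longleftrightarrow> d \<cdot>\<^bsub>Q\<^esub> a = b"
    if "a \<in> carrier Q" "b \<in> carrier Q" "d \<in> carrier Q" for a b d
    using theI'[OF right[OF that(1,2)]] the1_equality[OF right[OF that(1,2)], of d] that(3) by blast
  have the_eq: "(THE c. c \<in> carrier Q \<and> d = c) = d" if "d \<in> carrier Q" for d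
    using that by (intro the_equality) auto
  have Sym: "\<sigma> \<in> Sym Q \<longleftrightarrow> (\<forall>a\<in>carrier Q. \<forall>b\<in>carrier Q. parastrophe Q \<sigma> a b = a \<cdot>\<^bsub>Q\<^esub> b)"
    by (simp add: Sym_def \<sigma> del: One_nat_def)
  note para = parastrophe_eq_The[OF \<sigma>]
  show "\<sigma> 1 = 2 \<Longrightarrow> \<sigma> 2 = 1 \<Longrightarrow> \<sigma> 3 = 3 \<Longrightarrow> \<sigma> \<in> Sym Q \<longleftrightarrow> commutative Q"
    by (simp add: Sym para the_eq commutative_def closed) metis
  show "\<sigma> 1 = 1 \<Longrightarrow> \<sigma> 2 = 3 \<Longrightarrow> \<sigma> 3 = 2 \<Longrightarrow> \<sigma> \<in> Sym Q \<longleftrightarrow> left_symmetric Q"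
    by (simp add: Sym para left_symmetric_def closed the_left)
  show "\<sigma> 1 = 3 \<Longrightarrow> \<sigma> 2 = 2 \<Longrightarrow> \<sigma> 3 = 1 \<Longrightarrow> \<sigma> \<in> Sym Q \<longleftrightarrow> right_symmetric Q"
    by (simp add: Sym para right_symmetric_def closed the_right)
  show "\<sigma> 1 = 2 \<Longrightarrow> \<sigma> 2 = 3 \<Longrightarrow> \<sigma> 3 = 1 \<Longrightarrow> \<sigma> \<in> Sym Q \<longleftrightarrow> semi_symmetric Q"
    by (simp add: Sym para quasigroup_semi_symmetric_iff[OF Q] closed the_right)
  show "\<sigma> 1 = 3 \<Longrightarrow> \<sigma> 2 = 1 \<Longrightarrow> \<sigma> 3 = 2 \<Longrightarrow> \<sigma> \<in> Sym Q \<longleftrightarrow> semi_symmetric Q"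
    by (simp add: Sym para semi_symmetric_def closed the_left) blast
  show "\<sigma> 1 = 1 \<Longrightarrow> \<sigma> 2 = 2 \<Longrightarrow> \<sigma> 3 = 3 \<Longrightarrow> \<sigma> \<in> Sym Q"
    by (simp add: Sym para the_eq closed)
qed

lemma asymmetric_iff:
  assumes Q: "quasigroup Q"
  shows "asymmetric Q \<longleftrightarrow> \<not> commutative Q \<and> \<not> left_symmetric Q \<and> \<not> right_symmetric Q \<and>
    \<not> semi_symmetric Q"
proof
  assume "asymmetric Q"
  then have S: "Sym Q = {id}" by (simp add: asymmetric_def)
  let ?t = "transpose :: nat \<Rightarrow> nat \<Rightarrow> nat \<Rightarrow> nat"
  have perm: "?t 1 2 permutes {1, 2, 3}" "?t 2 3 permutes {1, 2, 3}" "?t 1 3 permutes {1, 2, 3}"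
    by (auto intro: permutes_swap_id)
  \<comment> \<open>This composite sends 1 to 2, 2 to 3 and 3 to 1. One 3-cycle is enough, since the
    other gives the same identity.\<close>
  then have cyc: "?t 1 2 \<circ> ?t 2 3 permutes {1, 2, 3}" by (blast intro: permutes_compose)
  have "?t 1 2 \<noteq> id" "?t 2 3 \<noteq> id" "?t 1 3 \<noteq> id" "?t 1 2 \<circ> ?t 2 3 \<noteq> id"
    by (auto simp: fun_eq_iff transpose_def intro: exI[of _ 1] exI[of _ 2])
  then have "?t 1 2 \<notin> Sym Q" "?t 2 3 \<notin> Sym Q" "?t 1 3 \<notin> Sym Q" "?t 1 2 \<circ> ?t 2 3 \<notin> Sym Q"
    by (simp_all add: S)
  with Sym_iff(1)[OF Q perm(1)] Sym_iff(2)[OF Q perm(2)] Sym_iff(3)[OF Q perm(3)]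
    Sym_iff(4)[OF Q cyc]
  show "\<not> commutative Q \<and> \<not> left_symmetric Q \<and> \<not> right_symmetric Q \<and> \<not> semi_symmetric Q"
    by (simp add: transpose_def)
next
  assume H: "\<not> commutative Q \<and> \<not> left_symmetric Q \<and> \<not> right_symmetric Q \<and> \<not> semi_symmetric Q"
  have "\<sigma> = id" if "\<sigma> \<in> Sym Q" for \<sigma>
  proof -
    have \<sigma>: "\<sigma> permutes {1, 2, 3}" using that by (simp add: Sym_def)
    then show ?thesis
      by (cases rule: permutes_123_cases) (use H that Sym_iff(1-5)[OF Q \<sigma>] in auto)
  qed
  moreover have "id \<in> Sym Q" by (rule Sym_iff(6)[OF Q permutes_id]) simp_all
  ultimately show "asymmetric Q" by (auto simp: asymmetric_def)
qed

section \<open>Isomorphism of magmas\<close>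

lemma magma_isomorphic_trans:
  assumes "magma_isomorphic Q R" "magma_isomorphic R S"
  shows "magma_isomorphic Q S"
proof -
  from assms obtain f g where f: "bij_betw f (carrier Q) (carrier R)"
      "\<forall>x\<in>carrier Q. \<forall>y\<in>carrier Q. f (x \<cdot>\<^bsub>Q\<^esub> y) = f x \<cdot>\<^bsub>R\<^esub> f y"
    and g: "bij_betw g (carrier R) (carrier S)"
      "\<forall>x\<in>carrier R. \<forall>y\<in>carrier R. g (x \<cdot>\<^bsub>R\<^esub> y) = g x \<cdot>\<^bsub>S\<^esub> g y"
    unfolding magma_isomorphic_def by auto
  have "f x \<in> carrier R" if "x \<in> carrier Q" for x
    using f(1) that by (rule bij_betwE[rule_format])
  with f(2) g(2) have "\<forall>x\<in>carrier Q. \<forall>y\<in>carrier Q. (g \<circ> f) (x \<cdot>\<^bsub>Q\<^esub> y) = (g \<circ> f) x \<cdot>\<^bsub>S\<^esub> (g \<circ> f) y"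
    by simp
  with bij_betw_trans[OF f(1) g(1)] show ?thesis
    unfolding magma_isomorphic_def by blast
qed

text \<open>Closure of \<open>Q\<close> places the product of two preimages in the domain on which
  the inverse map undoes \<open>f\<close>; \<open>magma_isomorphic\<close> alone does not provide
  this.\<close>

lemma magma_isomorphic_sym:
  assumes closed: "\<And>x y. \<lbrakk>x \<in> carrier Q; y \<in> carrier Q\<rbrakk> \<Longrightarrow> x \<cdot>\<^bsub>Q\<^esub> y \<in> carrier Q"
    and "magma_isomorphic Q R"
  shows "magma_isomorphic R Q"
proof -
  from assms(2) obtain f where f: "bij_betw f (carrier Q) (carrier R)"
      "\<forall>x\<in>carrier Q. \<forall>y\<in>carrier Q. f (x \<cdot>\<^bsub>Q\<^esub> y) = f x \<cdot>\<^bsub>R\<^esub> f y"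
    unfolding magma_isomorphic_def by auto
  define g where "g = inv_into (carrier Q) f"
  have g: "bij_betw g (carrier R) (carrier Q)"
    unfolding g_def by (rule bij_betw_inv_into[OF f(1)])
  have gf: "g (f x) = x" if "x \<in> carrier Q" for x
    using f(1) that by (simp add: g_def bij_betw_inv_into_left)
  have fg: "f (g x) = x" if "x \<in> carrier R" for x
    using f(1) that by (simp add: g_def bij_betw_inv_into_right)
  have "g (x \<cdot>\<^bsub>R\<^esub> y) = g x \<cdot>\<^bsub>Q\<^esub> g y" if "x \<in> carrier R" "y \<in> carrier R" for x y
  proof -
    have gx: "g x \<in> carrier Q" "g y \<in> carrier Q"
      using that g by (auto dest: bij_betwE)
    then have "x \<cdot>\<^bsub>R\<^esub> y = f (g x \<cdot>\<^bsub>Q\<^esub> g y)" using f(2) fg that by simp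
    then show ?thesis using gf[OF closed[OF gx]] by simp
  qed
  with g show ?thesis unfolding magma_isomorphic_def by blast
qed

section \<open>Residues modulo a prime and affine maps\<close>

lemma carrier_isotope: "carrier (isotope p (\<alpha>, \<beta>, d)) = {0..<int p}"
  by (auto simp: isotope_def residue_ring_def)

lemma mult_isotope: "x \<cdot>\<^bsub>isotope p (\<alpha>, \<beta>, d)\<^esub> y = (\<alpha> * x + \<beta> * y + d) mod int p"
  by (simp add: isotope_def residue_ring_def mod_simps)

lemma residue_eqI:
  fixes a b m :: int
  assumes "m dvd a - b" "0 \<le> a" "a < m" "0 \<le> b" "b < m"
  shows "a = b"
  using assms by (metis mod_eq_dvd_iff mod_pos_pos_trivial)

lemma residue_eq_minus_one_iff:
  fixes a m :: int
  assumes "0 \<le> a" "a < m"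
  shows "m dvd a + 1 \<longleftrightarrow> a = m - 1"
proof
  assume "m dvd a + 1"
  then have "m \<le> a + 1" using assms by (intro zdvd_imp_le) auto
  with assms show "a = m - 1" by simp
qed simp

lemma not_dvd_residue: "a \<in> {1..m - 1} \<Longrightarrow> \<not> m dvd a" for a m :: int
  using zdvd_not_zless[of a m] by simp

context
  fixes p :: nat
  assumes p: "prime p"
begin

lemma prime_dvd_mult_int_iff: "int p dvd a * b \<longleftrightarrow> int p dvd a \<or> int p dvd b"
  using p by (simp add: prime_dvd_mult_iff)

lemma int_prime_gt_1: "int p > 1"
  using prime_gt_1_nat[OF p] by simp

lemma unit_mod_prime:
  assumes "\<not> int p dvd a"
  obtains b where "int p dvd a * b - 1"
proof -
  have "coprime a (int p)"
    using assms p by (metis coprime_commute prime_imp_coprime prime_nat_int_transfer)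
  then obtain b where "[a * b = 1] (mod int p)" by (metis cong_solve_coprime_int)
  then show thesis using that by (simp add: cong_iff_dvd_diff)
qed

lemma bij_betw_affine:
  assumes "\<not> int p dvd u"
  shows "bij_betw (\<lambda>x. (u * x + v) mod int p) {0..<int p} {0..<int p}"
proof -
  have inj: "inj_on (\<lambda>x. (u * x + v) mod int p) {0..<int p}"
  proof (rule inj_onI)
    fix x y assume xy: "x \<in> {0..<int p}" "y \<in> {0..<int p}"
      and "(u * x + v) mod int p = (u * y + v) mod int p"
    then have "int p dvd u * (x - y)" by (simp add: mod_eq_dvd_iff algebra_simps)
    then have "int p dvd x - y" using assms by (simp add: prime_dvd_mult_int_iff)
    then show "x = y" using xy by (intro residue_eqI) auto
  qed
  moreover have "(\<lambda>x. (u * x + v) mod int p) ` {0..<int p} = {0..<int p}"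
    by (rule endo_inj_surj[OF _ _ inj]) (use int_prime_gt_1 in auto)
  ultimately show ?thesis by (simp add: bij_betw_def)
qed

text \<open>For the map \<open>u * x + v\<close> the terms in \<open>x\<close> and \<open>y\<close>
  on both sides of the homomorphism law agree automatically, so only the constant terms have to be
  compared; that is the second hypothesis.\<close>

lemma isotope_affine_isomorphic:
  assumes u: "\<not> int p dvd u" and v: "int p dvd u * d + v - ((\<alpha> + \<beta>) * v + d')"
  shows "magma_isomorphic (isotope p (\<alpha>, \<beta>, d)) (isotope p (\<alpha>, \<beta>, d'))"
proof -
  let ?h = "\<lambda>x. (u * x + v) mod int p"
  have "?h ((\<alpha> * x + \<beta> * y + d) mod int p) = (\<alpha> * ?h x + \<beta> * ?h y + d') mod int p" for x y
  proof -
    have "u * (\<alpha> * x + \<beta> * y + d) + v - (\<alpha> * (u * x + v) + \<beta> * (u * y + v) + d')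
        = u * d + v - ((\<alpha> + \<beta>) * v + d')"
      by (simp add: algebra_simps)
    then have "(u * (\<alpha> * x + \<beta> * y + d) + v) mod int p
        = (\<alpha> * (u * x + v) + \<beta> * (u * y + v) + d') mod int p"
      using v by (simp only: mod_eq_dvd_iff)
    moreover have "[u * ((\<alpha> * x + \<beta> * y + d) mod int p) + v
        = u * (\<alpha> * x + \<beta> * y + d) + v] (mod int p)"
      by (intro cong_add cong_mult cong_refl) (simp add: cong_def)
    moreover have "[\<alpha> * ?h x + \<beta> * ?h y + d'
        = \<alpha> * (u * x + v) + \<beta> * (u * y + v) + d'] (mod int p)"
      by (intro cong_add cong_mult cong_refl) (simp_all add: cong_def)
    ultimately show ?thesis unfolding cong_def by simp
  qed
  with bij_betw_affine[OF u, of v] show ?thesis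
    unfolding magma_isomorphic_def by (auto simp: carrier_isotope mult_isotope intro!: exI[of _ ?h])
qed

lemma isotope_quasigroup:
  assumes "\<not> int p dvd \<alpha>" "\<not> int p dvd \<beta>"
  shows "quasigroup (isotope p (\<alpha>, \<beta>, d))"
proof -
  have ex1: "\<exists>!x. x \<in> {0..<int p} \<and> (u * x + v) mod int p = b"
    if "\<not> int p dvd u" "b \<in> {0..<int p}" for u v b
  proof -
    have bij: "bij_betw (\<lambda>x. (u * x + v) mod int p) {0..<int p} {0..<int p}"
      by (rule bij_betw_affine[OF that(1)])
    then have "b \<in> (\<lambda>x. (u * x + v) mod int p) ` {0..<int p}"
      using that(2) by (simp add: bij_betw_def)
    then obtain x where x: "x \<in> {0..<int p}" "b = (u * x + v) mod int p" by blast
    show ?thesis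
    proof (rule ex1I[of _ x])
      fix y assume y: "y \<in> {0..<int p} \<and> (u * y + v) mod int p = b"
      then have "(u * y + v) mod int p = (u * x + v) mod int p" using x(2) by simp
      then show "y = x"
        by (rule inj_onD[OF bij_betw_imp_inj_on[OF bij]]) (use x(1) y in blast)+
    qed (use x in blast)
  qed
  show ?thesis
    unfolding quasigroup_def carrier_isotope mult_isotope
  proof (intro conjI ballI)
    fix a b :: int assume b: "b \<in> {0..<int p}"
    show "\<exists>!x. x \<in> {0..<int p} \<and> (\<alpha> * a + \<beta> * x + d) mod int p = b"
      using ex1[OF assms(2) b, of "\<alpha> * a + d"] by (simp add: algebra_simps)
    show "\<exists>!y. y \<in> {0..<int p} \<and> (\<alpha> * y + \<beta> * a + d) mod int p = b"
      using ex1[OF assms(1) b, of "\<beta> * a + d"] by (simp add: algebra_simps)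
  qed (use int_prime_gt_1 in simp)
qed

lemma Zmod_mult_iso:
  assumes "\<not> int p dvd u"
  shows "(\<lambda>x. u * x mod int p) \<in> iso (add_monoid (Zmod p)) (add_monoid (Zmod p))"
proof -
  have "{0..int p - 1} = {0..<int p}" by auto
  then show ?thesis
    using bij_betw_affine[OF assms, of 0] int_prime_gt_1
    by (auto simp: iso_def hom_def residue_ring_def mod_simps distrib_left)
qed

lemma isotope_linear_group_isotope:
  assumes ab: "\<not> int p dvd \<alpha>" "\<not> int p dvd \<beta>" and d: "d \<in> {0..<int p}"
  shows "linear_group_isotope (isotope p (\<alpha>, \<beta>, d))"
proof -
  let ?G = "add_monoid (Zmod p) :: int monoid"
  interpret R: residues "int p" "Zmod p"
    by unfold_locales (use int_prime_gt_1 in simp_all)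
  have "group ?G"
    using abelian_group.a_group[OF R.abelian_group] by simp
  moreover have "carrier ?G = carrier (isotope p (\<alpha>, \<beta>, d))"
    by (simp add: isotope_def)
  moreover have "\<forall>x\<in>carrier (isotope p (\<alpha>, \<beta>, d)). \<forall>y\<in>carrier (isotope p (\<alpha>, \<beta>, d)).
      x \<cdot>\<^bsub>isotope p (\<alpha>, \<beta>, d)\<^esub> y = (\<alpha> * x mod int p) \<otimes>\<^bsub>?G\<^esub> d \<otimes>\<^bsub>?G\<^esub> (\<beta> * y mod int p)"
    by (simp add: mult_isotope residue_ring_def mod_simps) (simp add: add_ac)
  moreover have "d \<in> carrier (isotope p (\<alpha>, \<beta>, d))" using d by (simp add: carrier_isotope)
  ultimately show ?thesis
    unfolding linear_group_isotope_def
    by (intro conjI isotope_quasigroup[OF ab] exI[of _ ?G] bexI[OF _ Zmod_mult_iso[OF ab(1)]]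
      bexI[OF _ Zmod_mult_iso[OF ab(2)]] bexI[of _ d])
qed

section \<open>Invariants of isomorphism\<close>

text \<open>
  Fixing one argument and varying the other shows that \<open>h\<close> is additive up to translation,
  since multiplication by \<open>\<alpha>\<close> and by \<open>\<beta>\<close> is surjective on residues.
\<close>

lemma isotope_hom_affine:
  assumes ab: "\<not> int p dvd \<alpha>" "\<not> int p dvd \<beta>"
    and hom: "\<And>x y. \<lbrakk>x \<in> {0..<int p}; y \<in> {0..<int p}\<rbrakk> \<Longrightarrow>
      h ((\<alpha> * x + \<beta> * y + d) mod int p) = (\<alpha>' * h x + \<beta>' * h y + d') mod int p"
  obtains a b where "\<And>x. x \<in> {0..<int p} \<Longrightarrow> int p dvd h x - (a * x + b)"
proof -
  \<comment> \<open>The periodic extension of \<open>h\<close> to all integers lets arguments be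
    added without reducing them.\<close>
  define H where "H x = h (x mod int p)" for x
  have H_mod: "H x = H y" if "int p dvd x - y" for x y
    using that by (simp add: H_def mod_eq_dvd_iff[symmetric])
  have H_hom: "int p dvd H (\<alpha> * x + \<beta> * y + d) - (\<alpha>' * H x + \<beta>' * H y + d')" for x y
  proof -
    have "H (\<alpha> * x + \<beta> * y + d) = h ((\<alpha> * (x mod int p) + \<beta> * (y mod int p) + d) mod int p)"
    proof -
      have "[\<alpha> * x + \<beta> * y + d = \<alpha> * (x mod int p) + \<beta> * (y mod int p) + d] (mod int p)"
        by (intro cong_add cong_mult cong_refl) (simp_all add: cong_def)
      then show ?thesis by (simp add: H_def cong_def)
    qed
    also have "\<dots> = (\<alpha>' * H x + \<beta>' * H y + d') mod int p"
      using int_prime_gt_1 by (subst hom) (simp_all add: H_def)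
    finally show ?thesis by (metis mod_eq_dvd_iff mod_mod_trivial)
  qed
  \<comment> \<open>Centring at \<open>d\<close>, the value of the operation at (0, 0), makes
    \<open>K 0\<close> vanish.\<close>
  define K where "K x = H (x + d) - H d" for x
  have K_add: "int p dvd K (x + y) - (K x + K y)" for x y
  proof -
    \<comment> \<open>Inverses of \<alpha> and \<beta> supply arguments at which the operation takes
      the value \<open>x + y + d\<close>.\<close>
    obtain a' b' where a': "int p dvd \<alpha> * a' - 1" and b': "int p dvd \<beta> * b' - 1"
      using ab unit_mod_prime by metis
    let ?x = "a' * x" and ?y = "b' * y"
    have x: "int p dvd \<alpha> * ?x - x"
      using dvd_mult2[OF a', of x] by (simp add: algebra_simps)
    have y: "int p dvd \<beta> * ?y - y"
      using dvd_mult2[OF b', of y] by (simp add: algebra_simps)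
    have "H (x + y + d) = H (\<alpha> * ?x + \<beta> * ?y + d)"
      using dvd_add[OF x y] by (intro H_mod) (simp add: dvd_diff_commute algebra_simps)
    moreover have "H (x + d) = H (\<alpha> * ?x + \<beta> * 0 + d)"
      using x by (intro H_mod) (simp add: dvd_diff_commute)
    moreover have "H (y + d) = H (\<alpha> * 0 + \<beta> * ?y + d)"
      using y by (intro H_mod) (simp add: dvd_diff_commute)
    moreover have "H d = H (\<alpha> * 0 + \<beta> * 0 + d)" by simp
    \<comment> \<open>Alternating sum of the homomorphism law over (\<open>?x\<close>,
      \<open>?y\<close>), (0, 0), (\<open>?x\<close>, 0), (0, \<open>?y\<close>): all terms with
      \<open>\<alpha>'\<close>, \<open>\<beta>'\<close> and \<open>d'\<close> cancel, leaving the
      additivity defect of \<open>K\<close>.\<close>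
    ultimately have
      "K (x + y) - (K x + K y)
        = (H (\<alpha> * ?x + \<beta> * ?y + d) - (\<alpha>' * H ?x + \<beta>' * H ?y + d'))
          + (H (\<alpha> * 0 + \<beta> * 0 + d) - (\<alpha>' * H 0 + \<beta>' * H 0 + d'))
          - (H (\<alpha> * ?x + \<beta> * 0 + d) - (\<alpha>' * H ?x + \<beta>' * H 0 + d'))
          - (H (\<alpha> * 0 + \<beta> * ?y + d) - (\<alpha>' * H 0 + \<beta>' * H ?y + d'))"
      unfolding K_def by linarith
    also have "int p dvd \<dots>" by (intro dvd_add dvd_diff H_hom)
    finally show ?thesis .
  qed
  have K_nat: "int p dvd K (int n) - int n * K 1" for n
  proof (induction n)
    case 0
    show ?case by (simp add: K_def)
  next
    case (Suc n)
    have "K (int (Suc n)) - int (Suc n) * K 1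
        = (K (int n + 1) - (K (int n) + K 1)) + (K (int n) - int n * K 1)"
      by (simp add: algebra_simps)
    also have "int p dvd \<dots>" by (rule dvd_add[OF K_add Suc.IH])
    finally show ?case .
  qed
  have "int p dvd h x - (K 1 * x + (H d - d * K 1))" if "x \<in> {0..<int p}" for x
  proof -
    \<comment> \<open>Linearity of \<open>K\<close> is known only at natural numbers, so
      \<open>x - d\<close> is replaced by its nonnegative residue.\<close>
    let ?n = "nat ((x - d) mod int p)"
    have n: "int ?n = (x - d) mod int p" using int_prime_gt_1 by simp
    then have dvd: "int p dvd int ?n - (x - d)"
      by (metis mod_eq_dvd_iff mod_mod_trivial)
    then have "H (int ?n + d) = H x"
      by (intro H_mod) (simp only: algebra_simps)
    moreover have "H x = h x" using that by (simp add: H_def)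
    ultimately have "h x - (K 1 * x + (H d - d * K 1))
        = (K (int ?n) - int ?n * K 1) + (int ?n - (x - d)) * K 1"
      unfolding K_def by (simp only: algebra_simps)
    also have "int p dvd \<dots>" using K_nat[of ?n] dvd by (intro dvd_add dvd_mult2)
    finally show ?thesis .
  qed
  then show thesis by (rule that)
qed

text \<open>An isomorphism is affine modulo \<open>p\<close>, with slope \<open>a\<close> nonzero
  because it separates 0 and 1. Comparing the law at (1, 0) and (0, 1) with the law at (0, 0)
  isolates \<open>a\<close> times each coefficient difference.\<close>

lemma isotope_isomorphic_coefficients:
  assumes ab: "\<not> int p dvd \<alpha>" "\<not> int p dvd \<beta>"
    and iso: "magma_isomorphic (isotope p (\<alpha>, \<beta>, d)) (isotope p (\<alpha>', \<beta>', d'))"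
  shows "int p dvd \<alpha> - \<alpha>'" and "int p dvd \<beta> - \<beta>'"
proof -
  from iso obtain h where bij: "bij_betw h {0..<int p} {0..<int p}"
    and hom: "\<And>x y. \<lbrakk>x \<in> {0..<int p}; y \<in> {0..<int p}\<rbrakk> \<Longrightarrow>
      h ((\<alpha> * x + \<beta> * y + d) mod int p) = (\<alpha>' * h x + \<beta>' * h y + d') mod int p"
    unfolding magma_isomorphic_def carrier_isotope mult_isotope by blast
  from isotope_hom_affine[OF ab hom] obtain a b
    where affine: "\<And>x. x \<in> {0..<int p} \<Longrightarrow> int p dvd h x - (a * x + b)" by blast
  have zero_one: "(0::int) \<in> {0..<int p}" "(1::int) \<in> {0..<int p}"
    using int_prime_gt_1 by auto
  have a: "\<not> int p dvd a"
  proof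
    assume "int p dvd a"
    then have "int p dvd (h 1 - (a * 1 + b)) - (h 0 - (a * 0 + b)) + a"
      by (intro dvd_add dvd_diff affine zero_one)
    then have "int p dvd h 1 - h 0" by simp
    moreover have "h 1 \<in> {0..<int p}" "h 0 \<in> {0..<int p}"
      using zero_one bij by (auto dest: bij_betwE)
    ultimately have "h 1 = h 0" by (intro residue_eqI) auto
    with inj_onD[OF bij_betw_imp_inj_on[OF bij], of 1 0] zero_one show False by simp
  qed
  \<comment> \<open>The homomorphism law is transported from \<open>h\<close> to its affine
    representative; the congruences numbered 1 to 4 account for the replacement errors.\<close>
  have eq: "int p dvd a * (\<alpha> * x + \<beta> * y + d) + b - (\<alpha>' * (a * x + b) + \<beta>' * (a * y + b) + d')"
    if "x \<in> {0..<int p}" "y \<in> {0..<int p}" for x y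
  proof -
    let ?z = "\<alpha> * x + \<beta> * y + d"
    have 1: "int p dvd (\<alpha>' * h x + \<beta>' * h y + d') - h (?z mod int p)"
      unfolding hom[OF that] by (metis mod_eq_dvd_iff mod_mod_trivial)
    have 2: "int p dvd h (?z mod int p) - (a * (?z mod int p) + b)"
      using int_prime_gt_1 by (intro affine) simp
    have 3: "int p dvd a * (?z mod int p - ?z)"
      by (intro dvd_mult) (metis mod_eq_dvd_iff mod_mod_trivial)
    have 4: "int p dvd \<alpha>' * (h x - (a * x + b))" "int p dvd \<beta>' * (h y - (a * y + b))"
      using affine that by auto
    have "a * ?z + b - (\<alpha>' * (a * x + b) + \<beta>' * (a * y + b) + d')
        = (\<alpha>' * (h x - (a * x + b)) + \<beta>' * (h y - (a * y + b)))
          - ((\<alpha>' * h x + \<beta>' * h y + d') - h (?z mod int p))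
          - (h (?z mod int p) - (a * (?z mod int p) + b)) - a * (?z mod int p - ?z)"
      by (simp add: right_diff_distrib)
    also have "int p dvd \<dots>" by (rule dvd_diff[OF dvd_diff[OF dvd_diff[OF dvd_add[OF 4] 1] 2] 3])
    finally show ?thesis .
  qed
  have "int p dvd a * (\<alpha> - \<alpha>')"
    using dvd_diff[OF eq[OF zero_one(2,1)] eq[OF zero_one(1,1)]] by (simp add: algebra_simps)
  moreover have "int p dvd a * (\<beta> - \<beta>')"
    using dvd_diff[OF eq[OF zero_one(1,2)] eq[OF zero_one(1,1)]] by (simp add: algebra_simps)
  ultimately show "int p dvd \<alpha> - \<alpha>'" "int p dvd \<beta> - \<beta>'"
    using a by (simp_all add: prime_dvd_mult_int_iff)
qed

text \<open>With constant term 0 the element 0 is idempotent, hence so is its image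
  \<open>h 0\<close>. When the target coefficients sum to 1, idempotency of any element forces the
  constant term to vanish.\<close>

lemma isotope_isomorphic_idempotent:
  assumes "magma_isomorphic (isotope p (\<alpha>, \<beta>, 0)) (isotope p (\<alpha>', \<beta>', d))"
    and "int p dvd \<alpha>' + \<beta>' - 1"
  shows "int p dvd d"
proof -
  from assms(1) obtain h where bij: "bij_betw h {0..<int p} {0..<int p}"
    and hom: "\<And>x y. \<lbrakk>x \<in> {0..<int p}; y \<in> {0..<int p}\<rbrakk> \<Longrightarrow>
      h ((\<alpha> * x + \<beta> * y + 0) mod int p) = (\<alpha>' * h x + \<beta>' * h y + d) mod int p"
    unfolding magma_isomorphic_def carrier_isotope mult_isotope by blast
  have "h 0 = (\<alpha>' * h 0 + \<beta>' * h 0 + d) mod int p"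
    using hom[of 0 0] int_prime_gt_1 by simp
  then have "int p dvd (\<alpha>' * h 0 + \<beta>' * h 0 + d) - h 0"
    by (metis mod_eq_dvd_iff mod_mod_trivial)
  from dvd_diff[OF this dvd_mult2[OF assms(2), of "h 0"]] show ?thesis by (simp add: algebra_simps)
qed

section \<open>Coordinates on a group of prime order\<close>

text \<open>Powers of a non-identity element \<open>a\<close> exhaust the group. In the exponent,
  automorphisms become multiplications by nonzero residues, and the fixed element \<open>c\<close>
  becomes the constant term.\<close>

lemma linear_group_isotope_obtain_isotope:
  assumes Q: "linear_group_isotope Q" "card (carrier Q) = p"
  obtains \<alpha> \<beta> d where "\<alpha> \<in> {1..int p - 1}" "\<beta> \<in> {1..int p - 1}" "d \<in> {0..<int p}"
    "magma_isomorphic (isotope p (\<alpha>, \<beta>, d)) Q"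
proof -
  from Q(1) obtain G \<phi> \<psi> c where "group (G :: 'a monoid)" and carrier: "carrier G = carrier Q"
    and \<phi>: "\<phi> \<in> iso G G" and \<psi>: "\<psi> \<in> iso G G" and c: "c \<in> carrier Q"
    and mult: "\<And>x y. \<lbrakk>x \<in> carrier Q; y \<in> carrier Q\<rbrakk> \<Longrightarrow>
      x \<cdot>\<^bsub>Q\<^esub> y = \<phi> x \<otimes>\<^bsub>G\<^esub> c \<otimes>\<^bsub>G\<^esub> \<psi> y"
    unfolding linear_group_isotope_def by metis
  interpret G: group G by fact
  have order: "order G = p" using Q(2) carrier by (simp add: order_def)
  have fin: "finite (carrier G)"
    using order prime_gt_0_nat[OF p] by (intro card_ge_0_finite) (simp add: order_def)
  have "carrier G \<noteq> {\<one>\<^bsub>G\<^esub>}"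
    using order prime_gt_1_nat[OF p] by (auto simp: order_def)
  then obtain a where a: "a \<in> carrier G" "a \<noteq> \<one>\<^bsub>G\<^esub>" using G.one_closed by blast
  have "G.ord a \<noteq> 1" using G.ord_eq_1[OF a(1)] a(2) by simp
  then have ord: "G.ord a = p"
    using G.ord_dvd_group_order[OF a(1)] p order unfolding prime_nat_iff by metis
  define e where "e n = a [^]\<^bsub>G\<^esub> (n :: int)" for n
  have e_closed: "e n \<in> carrier G" for n by (simp add: e_def a)
  have e_add: "e (m + n) = e m \<otimes>\<^bsub>G\<^esub> e n" for m n by (simp add: e_def a G.int_pow_mult)
  have e_eq: "e m = e n \<longleftrightarrow> int p dvd m - n" for m n
  proof -
    have "e m = e (m - n) \<otimes>\<^bsub>G\<^esub> e n" using e_add[of "m - n" n] by simp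
    then have "e m = e n \<longleftrightarrow> e (m - n) = \<one>\<^bsub>G\<^esub>"
      using e_closed by (simp add: G.r_cancel_one)
    then show ?thesis using G.int_pow_eq_id[OF a(1)] by (simp add: e_def ord)
  qed
  have e_mod: "e (n mod int p) = e n" for n
    by (simp add: e_eq mod_eq_dvd_iff[symmetric])
  have inj: "inj_on e {0..<int p}"
    by (rule inj_onI) (auto simp: e_eq intro: residue_eqI)
  have "e ` {0..<int p} = carrier G"
    by (rule card_subset_eq[OF fin]) (use e_closed card_image[OF inj] order in \<open>auto simp: order_def\<close>)
  with inj have bij: "bij_betw e {0..<int p} (carrier Q)"
    by (simp add: bij_betw_def carrier)
  have e_obtain: "\<exists>n\<in>{0..<int p}. e n = x" if "x \<in> carrier G" for x
    using that unfolding \<open>e ` {0..<int p} = carrier G\<close>[symmetric] by auto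
  \<comment> \<open>The multiplier is the exponent of \<open>f a\<close>; injectivity of
    \<open>f\<close> keeps it from being 0.\<close>
  have aut: "\<exists>\<alpha>\<in>{1..int p - 1}. \<forall>n. f (e n) = e (\<alpha> * n)" if f: "f \<in> iso G G" for f
  proof -
    have hom: "f \<in> hom G G" using f by (simp add: iso_def)
    interpret f: group_hom G G f
      by (simp add: group_hom_def group_hom_axioms_def hom G.is_group)
    obtain \<alpha> where \<alpha>: "\<alpha> \<in> {0..<int p}" "e \<alpha> = f a"
      using e_obtain[of "f a"] a by auto
    have "f a \<noteq> \<one>\<^bsub>G\<^esub>"
    proof
      assume "f a = \<one>\<^bsub>G\<^esub>"
      then have "f a = f \<one>\<^bsub>G\<^esub>" by simp
      moreover have "inj_on f (carrier G)" using f by (simp add: iso_def bij_betw_def)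
      ultimately have "a = \<one>\<^bsub>G\<^esub>" using a(1) G.one_closed by (metis inj_onD)
      with a(2) show False ..
    qed
    then have "\<alpha> \<noteq> 0" using \<alpha>(2) by (auto simp: e_def)
    moreover have "f (e n) = e (\<alpha> * n)" for n
      using \<alpha>(2) a by (simp add: e_def f.hom_int_pow G.int_pow_pow[symmetric])
    ultimately show ?thesis using \<alpha>(1) by (intro bexI[of _ \<alpha>]) auto
  qed
  obtain \<alpha> where \<alpha>: "\<alpha> \<in> {1..int p - 1}" "\<And>n. \<phi> (e n) = e (\<alpha> * n)" using aut[OF \<phi>] by blast
  obtain \<beta> where \<beta>: "\<beta> \<in> {1..int p - 1}" "\<And>n. \<psi> (e n) = e (\<beta> * n)" using aut[OF \<psi>] by blast
  obtain d where d: "d \<in> {0..<int p}" "e d = c" using e_obtain c carrier by blast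
  have "e ((\<alpha> * x + \<beta> * y + d) mod int p) = e x \<cdot>\<^bsub>Q\<^esub> e y" for x y
  proof -
    have "e x \<cdot>\<^bsub>Q\<^esub> e y = e (\<alpha> * x) \<otimes>\<^bsub>G\<^esub> e d \<otimes>\<^bsub>G\<^esub> e (\<beta> * y)"
      using mult e_closed carrier \<alpha>(2) \<beta>(2) d(2) by simp
    \<comment> \<open>The constant stands in the middle of the group product; it can be moved to the
      end because exponents add commutatively.\<close>
    also have "\<dots> = e (\<alpha> * x + d + \<beta> * y)" by (simp add: e_add)
    finally show ?thesis by (simp add: e_mod add_ac)
  qed
  with bij have "magma_isomorphic (isotope p (\<alpha>, \<beta>, d)) Q"
    unfolding magma_isomorphic_def carrier_isotope mult_isotope by blast
  with that \<alpha>(1) \<beta>(1) d(1) show thesis by blast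
qed

section \<open>The set \<open>M\<close> and normal forms\<close>

text \<open>For \<alpha> at least 2 the integer \<open>p + 1 - \<alpha>\<close> is below
  \<open>p\<close> and so already reduced; \<alpha> = 1 would give the residue 0.\<close>

lemma Zmod_one_minus:
  assumes "\<alpha> \<in> {2..int p - 1}"
  shows "1 \<ominus>\<^bsub>Zmod p\<^esub> \<alpha> = int p + 1 - \<alpha>"
proof -
  interpret R: residues "int p" "Zmod p"
    by unfold_locales (use prime_gt_1_nat[OF p] in simp_all)
  have "1 \<ominus>\<^bsub>Zmod p\<^esub> \<alpha> = (1 - \<alpha>) mod int p"
    by (simp add: a_minus_def R.res_neg_eq R.res_add_eq mod_simps)
  also have "\<dots> = (int p + 1 - \<alpha>) mod int p"
    by (simp add: mod_eq_dvd_iff)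
  also have "\<dots> = int p + 1 - \<alpha>" using assms by simp
  finally show ?thesis .
qed

lemma Zmod_inv_eqI:
  assumes "x \<in> {0..<int p}" "y \<in> {0..<int p}" "int p dvd x * y - 1"
  shows "inv\<^bsub>Zmod p\<^esub> x = y"
proof -
  have p1: "1 < int p" using prime_gt_1_nat[OF p] by simp
  interpret R: residues "int p" "Zmod p"
    by unfold_locales (use p1 in simp_all)
  have "(x * y) mod int p = 1"
    using assms(3) p1 by (simp add: mod_eq_dvd_iff[symmetric])
  then have "x \<otimes>\<^bsub>Zmod p\<^esub> y = \<one>\<^bsub>Zmod p\<^esub>" "y \<otimes>\<^bsub>Zmod p\<^esub> x = \<one>\<^bsub>Zmod p\<^esub>"
    by (simp_all add: R.res_mult_eq R.res_one_eq mult.commute)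
  moreover have "x \<in> carrier (Zmod p)" "y \<in> carrier (Zmod p)"
    using assms by (simp_all add: R.res_carrier_eq)
  ultimately show ?thesis
    by (intro R.inv_unique'[symmetric])
qed

text \<open>Trades subtraction in the field for the integer equation
  \<open>\<alpha> + \<beta> = int p + 1\<close>, which is symmetric and open to linear
  arithmetic.\<close>

lemma mem_M_iff:
  "(\<alpha>, \<beta>, d) \<in> M p \<longleftrightarrow> \<alpha> \<in> {1..int p - 1} \<and> \<beta> \<in> {1..int p - 1} \<and>
    (d = 0 \<or> d = 1 \<and> \<alpha> + \<beta> = int p + 1)"
proof
  assume "(\<alpha>, \<beta>, d) \<in> M p"
  then show "\<alpha> \<in> {1..int p - 1} \<and> \<beta> \<in> {1..int p - 1} \<and>
    (d = 0 \<or> d = 1 \<and> \<alpha> + \<beta> = int p + 1)"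
    unfolding M_def by (auto simp: Zmod_one_minus)
next
  assume H: "\<alpha> \<in> {1..int p - 1} \<and> \<beta> \<in> {1..int p - 1} \<and>
    (d = 0 \<or> d = 1 \<and> \<alpha> + \<beta> = int p + 1)"
  show "(\<alpha>, \<beta>, d) \<in> M p"
  proof (cases "d = 0")
    case False
    with H have "\<alpha> \<in> {2..int p - 1}" "\<beta> = int p + 1 - \<alpha>" "d = 1" by auto
    then show ?thesis unfolding M_def using Zmod_one_minus[of \<alpha>] by auto
  qed (use H in \<open>auto simp: M_def\<close>)
qed

lemma mem_M_cases:
  assumes "t \<in> M p"
  obtains \<alpha> \<beta> d where "t = (\<alpha>, \<beta>, d)" "\<alpha> \<in> {1..int p - 1}" "\<beta> \<in> {1..int p - 1}"
    "d \<in> {0..<int p}" "d = 0 \<or> d = 1 \<and> \<alpha> + \<beta> = int p + 1"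
proof -
  obtain \<alpha> \<beta> d where t: "t = (\<alpha>, \<beta>, d)" by (cases t)
  with assms have "\<alpha> \<in> {1..int p - 1} \<and> \<beta> \<in> {1..int p - 1} \<and>
    (d = 0 \<or> d = 1 \<and> \<alpha> + \<beta> = int p + 1)" by (simp only: mem_M_iff)
  with that t prime_gt_1_nat[OF p] show thesis by auto
qed

lemma isotope_isomorphic_mem_M:
  assumes ab: "\<alpha> \<in> {1..int p - 1}" "\<beta> \<in> {1..int p - 1}" and d: "d \<in> {0..<int p}"
  obtains t where "t \<in> M p" "magma_isomorphic (isotope p (\<alpha>, \<beta>, d)) (isotope p t)"
proof (cases "int p dvd \<alpha> + \<beta> - 1")
  case False
  \<comment> \<open>\<open>d * w\<close> is the idempotent of the isotope, and the translation by
    its negative moves it to 0.\<close>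
  then obtain w where "int p dvd (1 - (\<alpha> + \<beta>)) * w - 1"
    by (metis unit_mod_prime dvd_diff_commute)
  from dvd_mult2[OF this, of "-d"]
  have "magma_isomorphic (isotope p (\<alpha>, \<beta>, d)) (isotope p (\<alpha>, \<beta>, 0))"
    using prime_gt_1_nat[OF p]
    by (intro isotope_affine_isomorphic[of 1 _ "- (d * w)"]) (simp_all add: algebra_simps)
  moreover have "(\<alpha>, \<beta>, 0) \<in> M p" using ab by (simp add: mem_M_iff)
  ultimately show thesis using that by blast
next
  case True
  then obtain k where k: "\<alpha> + \<beta> - 1 = int p * k" by blast
  \<comment> \<open>The sum minus 1 lies strictly between 0 and \<open>2 * p\<close>, so it can only
    be \<open>p\<close> itself.\<close>
  have "0 < int p * k" "int p * k < int p * 2" unfolding k[symmetric] using ab by auto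
  then have "k = 1" by (simp add: zero_less_mult_iff)
  with k have sum: "\<alpha> + \<beta> = int p + 1" by simp
  show thesis
  proof (cases "d = 0")
    case True
    have "magma_isomorphic (isotope p (\<alpha>, \<beta>, 0)) (isotope p (\<alpha>, \<beta>, 0))"
      unfolding magma_isomorphic_def by (intro exI[of _ id]) simp
    moreover have "(\<alpha>, \<beta>, 0) \<in> M p" using ab by (simp add: mem_M_iff)
    ultimately show thesis using that True by blast
  next
    case False
    then have "\<not> int p dvd d" using d by (intro not_dvd_residue) auto
    \<comment> \<open>Here translations leave the constant term unchanged; scaling by the inverse of
      \<open>d\<close> turns it into 1.\<close>
    then obtain w where w: "int p dvd d * w - 1" by (rule unit_mod_prime)
    have "\<not> int p dvd w"
    proof
      assume "int p dvd w"
      from dvd_diff[OF dvd_mult[OF this, of d] w] show False using prime_gt_1_nat[OF p] by simp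
    qed
    then have "magma_isomorphic (isotope p (\<alpha>, \<beta>, d)) (isotope p (\<alpha>, \<beta>, 1))"
      using w by (intro isotope_affine_isomorphic[of w _ 0]) (simp_all add: mult.commute)
    moreover have "(\<alpha>, \<beta>, 1) \<in> M p" using ab sum by (simp add: mem_M_iff)
    ultimately show thesis using that by blast
  qed
qed

lemma isotope_isomorphic_imp_eq:
  assumes "s \<in> M p" "t \<in> M p" and iso: "magma_isomorphic (isotope p s) (isotope p t)"
  shows "s = t"
proof -
  obtain \<alpha> \<beta> d where s: "s = (\<alpha>, \<beta>, d)" "\<alpha> \<in> {1..int p - 1}" "\<beta> \<in> {1..int p - 1}"
    "d = 0 \<or> d = 1 \<and> \<alpha> + \<beta> = int p + 1" using assms(1) by (rule mem_M_cases)
  obtain \<alpha>' \<beta>' d' where t: "t = (\<alpha>', \<beta>', d')" "\<alpha>' \<in> {1..int p - 1}" "\<beta>' \<in> {1..int p - 1}"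
    "d' = 0 \<or> d' = 1 \<and> \<alpha>' + \<beta>' = int p + 1" using assms(2) by (rule mem_M_cases)
  note units = not_dvd_residue[OF s(2)] not_dvd_residue[OF s(3)]
  note iso = iso[unfolded s(1) t(1)]
  from isotope_isomorphic_coefficients[OF units iso] have eq: "\<alpha> = \<alpha>'" "\<beta> = \<beta>'"
    using s(2,3) t(2,3) by (auto intro: residue_eqI)
  \<comment> \<open>The idempotent argument starts from the side with constant term 0, which may be
    either one, so both directions are required.\<close>
  have sym: "magma_isomorphic (isotope p (\<alpha>', \<beta>', d')) (isotope p (\<alpha>, \<beta>, d))"
    by (rule magma_isomorphic_sym[OF _ iso], rule quasigroup_closed[OF isotope_quasigroup[OF units]])
  have not1: "\<not> int p dvd 1" using prime_gt_1_nat[OF p] by simp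
  have "d = d'"
  proof (rule ccontr)
    assume "d \<noteq> d'"
    then consider "d = 0" "d' = 1" "\<alpha>' + \<beta>' = int p + 1" | "d' = 0" "d = 1" "\<alpha> + \<beta> = int p + 1"
      using s(4) t(4) by auto
    then show False
    proof cases
      case 1
      with isotope_isomorphic_idempotent[of \<alpha> \<beta> \<alpha>' \<beta>' d'] iso not1 show False by simp
    next
      case 2
      with isotope_isomorphic_idempotent[of \<alpha>' \<beta>' \<alpha> \<beta> d] sym not1 show False by simp
    qed
  qed
  with eq s(1) t(1) show ?thesis by simp
qed

section \<open>Symmetry properties as congruences\<close>

lemma isotope_commutative_iff:
  assumes "\<alpha> \<in> {1..int p - 1}" "\<beta> \<in> {1..int p - 1}"
  shows "commutative (isotope p (\<alpha>, \<beta>, d)) \<longleftrightarrow> \<alpha> = \<beta>"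
proof
  assume "commutative (isotope p (\<alpha>, \<beta>, d))"
  then have "(\<alpha> * 1 + \<beta> * 0 + d) mod int p = (\<alpha> * 0 + \<beta> * 1 + d) mod int p"
    unfolding commutative_def carrier_isotope mult_isotope using prime_gt_1_nat[OF p]
    by (elim ballE[of _ _ 1] ballE[of _ _ 0]) simp_all
  then show "\<alpha> = \<beta>" using assms by (auto simp: mod_eq_dvd_iff intro: residue_eqI)
qed (simp add: commutative_def mult_isotope add.commute)

text \<open>The difference of the two sides of the law factors through \<open>\<beta> + 1\<close>.
  Subtracting its values at (1, 0) and (0, 0) leaves \<open>(\<beta> + 1) * \<alpha>\<close>, where
  \<alpha> is a unit.\<close>

lemma isotope_left_symmetric_iff:
  assumes "\<alpha> \<in> {1..int p - 1}" "\<beta> \<in> {1..int p - 1}"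
  shows "left_symmetric (isotope p (\<alpha>, \<beta>, d)) \<longleftrightarrow> \<beta> = int p - 1"
proof -
  have eq: "(\<alpha> * x + \<beta> * ((\<alpha> * x + \<beta> * y + d) mod int p) + d) mod int p = y \<longleftrightarrow>
      int p dvd (\<beta> + 1) * (\<alpha> * x + d + (\<beta> - 1) * y)" if "y \<in> {0..<int p}" for x y
  proof -
    have "[\<alpha> * x + \<beta> * ((\<alpha> * x + \<beta> * y + d) mod int p) + d
        = \<alpha> * x + \<beta> * (\<alpha> * x + \<beta> * y + d) + d] (mod int p)"
      by (intro cong_add cong_mult cong_refl) (simp add: cong_def)
    then have "(\<alpha> * x + \<beta> * ((\<alpha> * x + \<beta> * y + d) mod int p) + d) mod int p = y \<longleftrightarrow>
        (\<alpha> * x + \<beta> * (\<alpha> * x + \<beta> * y + d) + d) mod int p = y mod int p"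
      using that by (simp add: cong_def)
    also have "\<dots> \<longleftrightarrow> int p dvd (\<beta> + 1) * (\<alpha> * x + d + (\<beta> - 1) * y)"
      by (simp add: mod_eq_dvd_iff algebra_simps)
    finally show ?thesis .
  qed
  have "left_symmetric (isotope p (\<alpha>, \<beta>, d)) \<longleftrightarrow>
      (\<forall>x\<in>{0..<int p}. \<forall>y\<in>{0..<int p}. int p dvd (\<beta> + 1) * (\<alpha> * x + d + (\<beta> - 1) * y))"
    unfolding left_symmetric_def carrier_isotope mult_isotope using eq by simp
  also have "\<dots> \<longleftrightarrow> int p dvd \<beta> + 1"
  proof
    assume H: "\<forall>x\<in>{0..<int p}. \<forall>y\<in>{0..<int p}. int p dvd (\<beta> + 1) * (\<alpha> * x + d + (\<beta> - 1) * y)"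
    have "int p dvd (\<beta> + 1) * (\<alpha> * 1 + d + (\<beta> - 1) * 0) - (\<beta> + 1) * (\<alpha> * 0 + d + (\<beta> - 1) * 0)"
      using prime_gt_1_nat[OF p] by (intro dvd_diff H[rule_format]) auto
    then have "int p dvd (\<beta> + 1) * \<alpha>" by (simp add: algebra_simps)
    then show "int p dvd \<beta> + 1"
      using not_dvd_residue[OF assms(1)] by (simp add: prime_dvd_mult_int_iff)
  qed simp
  also have "\<dots> \<longleftrightarrow> \<beta> = int p - 1"
    using assms by (intro residue_eq_minus_one_iff) auto
  finally show ?thesis .
qed

text \<open>Exchanging the two arguments swaps \<alpha> with \<beta> and right with left
  symmetry.\<close>

lemma isotope_right_symmetric_iff:
  assumes "\<alpha> \<in> {1..int p - 1}" "\<beta> \<in> {1..int p - 1}"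
  shows "right_symmetric (isotope p (\<alpha>, \<beta>, d)) \<longleftrightarrow> \<alpha> = int p - 1"
proof -
  have swap: "x \<cdot>\<^bsub>isotope p (\<alpha>, \<beta>, d)\<^esub> y = y \<cdot>\<^bsub>isotope p (\<beta>, \<alpha>, d)\<^esub> x" for x y
    by (simp add: mult_isotope add.commute)
  have "right_symmetric (isotope p (\<alpha>, \<beta>, d)) \<longleftrightarrow> left_symmetric (isotope p (\<beta>, \<alpha>, d))"
    unfolding right_symmetric_def left_symmetric_def carrier_isotope swap by blast
  with isotope_left_symmetric_iff[OF assms(2,1)] show ?thesis by simp
qed

text \<open>The law is the vanishing of an affine polynomial in \<open>x\<close> and
  \<open>y\<close> on all residues; evaluation at (0, 0), (1, 0) and (0, 1) yields its three
  coefficients.\<close>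

lemma isotope_semi_symmetric_iff:
  "semi_symmetric (isotope p (\<alpha>, \<beta>, d)) \<longleftrightarrow>
    int p dvd \<alpha> * \<beta> - 1 \<and> int p dvd \<alpha> + \<beta>\<^sup>2 \<and> int p dvd (\<beta> + 1) * d"
proof -
  have eq: "(\<alpha> * x + \<beta> * ((\<alpha> * y + \<beta> * x + d) mod int p) + d) mod int p = y \<longleftrightarrow>
      int p dvd (\<alpha> + \<beta>\<^sup>2) * x + (\<alpha> * \<beta> - 1) * y + (\<beta> + 1) * d" if "y \<in> {0..<int p}" for x y
  proof -
    have "[\<alpha> * x + \<beta> * ((\<alpha> * y + \<beta> * x + d) mod int p) + d
        = \<alpha> * x + \<beta> * (\<alpha> * y + \<beta> * x + d) + d] (mod int p)"
      by (intro cong_add cong_mult cong_refl) (simp add: cong_def)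
    then have "(\<alpha> * x + \<beta> * ((\<alpha> * y + \<beta> * x + d) mod int p) + d) mod int p = y \<longleftrightarrow>
        (\<alpha> * x + \<beta> * (\<alpha> * y + \<beta> * x + d) + d) mod int p = y mod int p"
      using that by (simp add: cong_def)
    also have "\<dots> \<longleftrightarrow> int p dvd (\<alpha> + \<beta>\<^sup>2) * x + (\<alpha> * \<beta> - 1) * y + (\<beta> + 1) * d"
      by (simp add: mod_eq_dvd_iff algebra_simps power2_eq_square)
    finally show ?thesis .
  qed
  have "semi_symmetric (isotope p (\<alpha>, \<beta>, d)) \<longleftrightarrow> (\<forall>x\<in>{0..<int p}. \<forall>y\<in>{0..<int p}.
      int p dvd (\<alpha> + \<beta>\<^sup>2) * x + (\<alpha> * \<beta> - 1) * y + (\<beta> + 1) * d)"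
    unfolding semi_symmetric_def carrier_isotope mult_isotope using eq by simp
  also have "\<dots> \<longleftrightarrow> int p dvd \<alpha> * \<beta> - 1 \<and> int p dvd \<alpha> + \<beta>\<^sup>2 \<and> int p dvd (\<beta> + 1) * d"
  proof
    assume H: "\<forall>x\<in>{0..<int p}. \<forall>y\<in>{0..<int p}.
      int p dvd (\<alpha> + \<beta>\<^sup>2) * x + (\<alpha> * \<beta> - 1) * y + (\<beta> + 1) * d"
    have d: "int p dvd (\<alpha> + \<beta>\<^sup>2) * 0 + (\<alpha> * \<beta> - 1) * 0 + (\<beta> + 1) * d"
      and x: "int p dvd (\<alpha> + \<beta>\<^sup>2) * 1 + (\<alpha> * \<beta> - 1) * 0 + (\<beta> + 1) * d"
      and y: "int p dvd (\<alpha> + \<beta>\<^sup>2) * 0 + (\<alpha> * \<beta> - 1) * 1 + (\<beta> + 1) * d"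
      using prime_gt_1_nat[OF p] by (intro H[rule_format]; simp)+
    show "int p dvd \<alpha> * \<beta> - 1 \<and> int p dvd \<alpha> + \<beta>\<^sup>2 \<and> int p dvd (\<beta> + 1) * d"
      using d dvd_diff[OF x d] dvd_diff[OF y d] by simp
  qed (auto intro: dvd_add dvd_mult2)
  finally show ?thesis .
qed

lemma isotope_totally_symmetric_iff:
  assumes "\<alpha> \<in> {1..int p - 1}" "\<beta> \<in> {1..int p - 1}"
  shows "totally_symmetric (isotope p (\<alpha>, \<beta>, d)) \<longleftrightarrow> \<alpha> = int p - 1 \<and> \<beta> = int p - 1"
proof -
  have "totally_symmetric Q \<longleftrightarrow> commutative Q \<and> right_symmetric Q" for Q :: "int magma"
    unfolding totally_symmetric_def commutative_def right_symmetric_def by blast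
  then show ?thesis
    using isotope_commutative_iff[OF assms] isotope_right_symmetric_iff[OF assms] by auto
qed

section \<open>Classification up to isomorphism\<close>

lemma linear_group_isotope_classification:
  assumes Q: "linear_group_isotope Q" "card (carrier Q) = p"
  shows "\<exists>!t. t \<in> M p \<and> magma_isomorphic Q (isotope p t)"
proof -
  have closed: "x \<cdot>\<^bsub>Q\<^esub> y \<in> carrier Q" if "x \<in> carrier Q" "y \<in> carrier Q" for x y
    using Q(1) that by (simp add: linear_group_isotope_def quasigroup_closed)
  obtain \<alpha> \<beta> d where ab: "\<alpha> \<in> {1..int p - 1}" "\<beta> \<in> {1..int p - 1}" and d: "d \<in> {0..<int p}"
    and iso: "magma_isomorphic (isotope p (\<alpha>, \<beta>, d)) Q"
    using linear_group_isotope_obtain_isotope[OF Q] .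
  obtain t where t: "t \<in> M p" "magma_isomorphic (isotope p (\<alpha>, \<beta>, d)) (isotope p t)"
    using isotope_isomorphic_mem_M[OF ab d] .
  note quasigroup = isotope_quasigroup[OF not_dvd_residue[OF ab(1)] not_dvd_residue[OF ab(2)]]
  have "magma_isomorphic Q (isotope p (\<alpha>, \<beta>, d))"
    by (rule magma_isomorphic_sym[OF _ iso], rule quasigroup_closed[OF quasigroup])
  from magma_isomorphic_trans[OF this t(2)] have Qt: "magma_isomorphic Q (isotope p t)" .
  show ?thesis
  proof (rule ex1I[of _ t])
    fix s assume s: "s \<in> M p \<and> magma_isomorphic Q (isotope p s)"
    have "magma_isomorphic (isotope p t) Q" by (rule magma_isomorphic_sym[OF closed Qt])
    from magma_isomorphic_trans[OF this] s have "magma_isomorphic (isotope p t) (isotope p s)"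
      by blast
    then show "s = t" using isotope_isomorphic_imp_eq[OF t(1)] s by blast
  qed (use t Qt in blast)
qed

section \<open>Membership in the six classes\<close>

lemma mem_M_units:
  assumes "(\<alpha>, \<beta>, d) \<in> M p"
  shows "\<alpha> \<in> {1..int p - 1}" "\<beta> \<in> {1..int p - 1}"
  using assms by (simp_all add: mem_M_iff)

lemma mem_M_ts_iff:
  "(\<alpha>, \<beta>, d) \<in> M_ts p \<longleftrightarrow> (\<alpha>, \<beta>, d) \<in> M p \<and> \<alpha> = int p - 1 \<and> \<beta> = int p - 1"
  unfolding M_ts_def using isotope_totally_symmetric_iff[OF mem_M_units] by blast

lemma mem_M_cs_iff:
  "(\<alpha>, \<beta>, d) \<in> M_cs p \<longleftrightarrow> (\<alpha>, \<beta>, d) \<in> M p \<and> \<alpha> = \<beta> \<and> \<alpha> \<noteq> int p - 1"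
  unfolding M_cs_def strictly_def
  using isotope_totally_symmetric_iff[OF mem_M_units] isotope_commutative_iff[OF mem_M_units]
  by blast

lemma mem_M_ls_iff:
  "(\<alpha>, \<beta>, d) \<in> M_ls p \<longleftrightarrow> (\<alpha>, \<beta>, d) \<in> M p \<and> \<beta> = int p - 1 \<and> \<alpha> \<noteq> int p - 1"
  unfolding M_ls_def strictly_def
  using isotope_totally_symmetric_iff[OF mem_M_units] isotope_left_symmetric_iff[OF mem_M_units]
  by blast

lemma mem_M_rs_iff:
  "(\<alpha>, \<beta>, d) \<in> M_rs p \<longleftrightarrow> (\<alpha>, \<beta>, d) \<in> M p \<and> \<alpha> = int p - 1 \<and> \<beta> \<noteq> int p - 1"
  unfolding M_rs_def strictly_def
  using isotope_totally_symmetric_iff[OF mem_M_units] isotope_right_symmetric_iff[OF mem_M_units]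
  by blast

lemma mem_M_ss_iff_strict:
  "(\<alpha>, \<beta>, d) \<in> M_ss p \<longleftrightarrow> (\<alpha>, \<beta>, d) \<in> M p \<and> semi_symmetric (isotope p (\<alpha>, \<beta>, d)) \<and>
    \<not> (\<alpha> = int p - 1 \<and> \<beta> = int p - 1)"
  unfolding M_ss_def strictly_def
  using isotope_totally_symmetric_iff[OF mem_M_units] by blast

text \<open>Total symmetry would force \<open>\<alpha> = int p - 1\<close>, which is already
  excluded, so absence from \<open>M_ss\<close> expresses failure of semi-symmetry.\<close>

lemma mem_M_as_iff:
  "(\<alpha>, \<beta>, d) \<in> M_as p \<longleftrightarrow> (\<alpha>, \<beta>, d) \<in> M p \<and> \<alpha> \<noteq> \<beta> \<and> \<alpha> \<noteq> int p - 1 \<and> \<beta> \<noteq> int p - 1 \<and>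
    (\<alpha>, \<beta>, d) \<notin> M_ss p"
proof (cases "(\<alpha>, \<beta>, d) \<in> M p")
  case True
  note ab = mem_M_units[OF True]
  have "quasigroup (isotope p (\<alpha>, \<beta>, d))"
    by (rule isotope_quasigroup[OF not_dvd_residue[OF ab(1)] not_dvd_residue[OF ab(2)]])
  from asymmetric_iff[OF this] True show ?thesis
    unfolding M_as_def mem_M_ss_iff_strict isotope_commutative_iff[OF ab]
      isotope_left_symmetric_iff[OF ab] isotope_right_symmetric_iff[OF ab]
    by blast
qed (simp add: M_as_def)

text \<open>The residue -1 is its own inverse. Thus strictness of a semi-symmetric triple can be
  tested on \<alpha> alone.\<close>

lemma semi_symmetric_minus_one_iff:
  assumes ab: "\<alpha> \<in> {1..int p - 1}" "\<beta> \<in> {1..int p - 1}" and inv: "int p dvd \<alpha> * \<beta> - 1"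
  shows "\<alpha> = int p - 1 \<longleftrightarrow> \<beta> = int p - 1"
proof -
  have "int p dvd x + 1 \<Longrightarrow> int p dvd x * y - 1 \<Longrightarrow> int p dvd y + 1" for x y
  proof -
    assume "int p dvd x + 1" "int p dvd x * y - 1"
    from dvd_diff[OF dvd_mult2[OF this(1), of y] this(2)] show "int p dvd y + 1" by (simp add: algebra_simps)
  qed
  from this[of \<alpha> \<beta>] this[of \<beta> \<alpha>] inv have "int p dvd \<alpha> + 1 \<longleftrightarrow> int p dvd \<beta> + 1"
    by (auto simp: mult.commute)
  with residue_eq_minus_one_iff[of \<alpha> "int p"] residue_eq_minus_one_iff[of \<beta> "int p"] ab
  show ?thesis by simp
qed

text \<open>For \<open>d = 1\<close> the condition on \<open>(\<beta> + 1) * d\<close> would make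
  \<beta>, and then its inverse \<alpha>, equal to -1, which is the totally symmetric case. Hence
  \<open>d = 0\<close>.\<close>

lemma mem_M_ss_iff:
  "(\<alpha>, \<beta>, d) \<in> M_ss p \<longleftrightarrow> (\<alpha>, \<beta>, d) \<in> M p \<and> d = 0 \<and> int p dvd \<alpha> * \<beta> - 1 \<and>
    int p dvd \<alpha> + \<beta>\<^sup>2 \<and> \<alpha> \<noteq> int p - 1"
proof (cases "(\<alpha>, \<beta>, d) \<in> M p")
  case True
  note ab = mem_M_units[OF True]
  have "\<beta> = int p - 1" if "int p dvd \<beta> + 1"
    using that ab residue_eq_minus_one_iff[of \<beta> "int p"] by simp
  moreover have "d = 0 \<or> d = 1" using True by (auto simp: mem_M_iff)
  ultimately show ?thesis
    unfolding mem_M_ss_iff_strict isotope_semi_symmetric_iff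
    using semi_symmetric_minus_one_iff[OF ab] by auto
qed (simp add: M_ss_def)

lemma Zmod_inv_inverse:
  assumes "x \<in> {1..int p - 1}"
  shows "inv\<^bsub>Zmod p\<^esub> x \<in> {0..<int p}" "int p dvd x * inv\<^bsub>Zmod p\<^esub> x - 1"
proof -
  obtain y where y: "int p dvd x * y - 1" using unit_mod_prime[OF not_dvd_residue[OF assms]] .
  have "int p dvd x * (y mod int p - y) + (x * y - 1)"
    using y by (intro dvd_add dvd_mult) (simp_all add: mod_eq_dvd_iff[symmetric])
  then have y': "int p dvd x * (y mod int p) - 1" by (simp add: algebra_simps)
  have range: "y mod int p \<in> {0..<int p}" using prime_gt_0_nat[OF p] by simp
  from y' have "inv\<^bsub>Zmod p\<^esub> x = y mod int p"
    by (intro Zmod_inv_eqI) (use assms range in auto)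
  with y' range show "inv\<^bsub>Zmod p\<^esub> x \<in> {0..<int p}" "int p dvd x * inv\<^bsub>Zmod p\<^esub> x - 1"
    by simp_all
qed

end

section \<open>Semi-symmetric triples for primes above 3\<close>

context
  fixes p :: nat
  assumes p: "prime p" and p3: "p > 3"
begin

text \<open>2 and 4 are divided out when solving the quadratic for \<alpha>, and 4 also keeps
  \<open>1 + e\<close> invertible when \<open>e\<close> squares to -3; 3 separates the root -1 from
  the roots of the quadratic.\<close>

lemma prime_gt_3_not_dvd: "\<not> int p dvd 2" "\<not> int p dvd 3" "\<not> int p dvd 4"
proof -
  show 2: "\<not> int p dvd 2" "\<not> int p dvd 3" using p3 zdvd_not_zless[of 2 "int p"] zdvd_not_zless[of 3 "int p"] by auto
  show "\<not> int p dvd 4" using 2(1) prime_dvd_mult_int_iff[OF p, of 2 2] by simp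
qed

text \<open>
  With \<open>\<alpha>\<beta> = 1\<close> the equation \<open>\<alpha> + \<beta>\<^sup>2 = 0\<close> becomes \<open>\<alpha>\<^sup>3 + 1 = 0\<close>; away from \<open>\<alpha> = -1\<close> this means
  \<open>\<alpha>\<^sup>2 - \<alpha> + 1 = 0\<close>, where the square is then completed.
\<close>

lemma semi_symmetric_discriminant_iff:
  assumes \<alpha>: "\<alpha> \<in> {1..int p - 1}" and inv: "int p dvd \<alpha> * \<beta> - 1"
  shows "int p dvd \<alpha> + \<beta>\<^sup>2 \<and> \<alpha> \<noteq> int p - 1 \<longleftrightarrow> int p dvd (2 * \<alpha> - 1)\<^sup>2 + 3"
proof -
  have minus_one: "\<alpha> = int p - 1 \<longleftrightarrow> int p dvd \<alpha> + 1"
    using \<alpha> residue_eq_minus_one_iff[of \<alpha> "int p"] by simp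
  \<comment> \<open>Modulo \<open>\<alpha> * \<beta> - 1\<close> the term
    \<open>\<alpha>\<^sup>2 * \<beta>\<^sup>2\<close> is 1, so \<open>\<alpha>\<^sup>3 + 1\<close>
    remains, here in factored form.\<close>
  have "\<alpha>\<^sup>2 * (\<alpha> + \<beta>\<^sup>2) = (\<alpha> * \<beta> - 1) * (\<alpha> * \<beta> + 1) + (\<alpha> + 1) * (\<alpha>\<^sup>2 - \<alpha> + 1)"
    by (simp add: power2_eq_square algebra_simps)
  then have "int p dvd \<alpha>\<^sup>2 * (\<alpha> + \<beta>\<^sup>2) \<longleftrightarrow> int p dvd (\<alpha> + 1) * (\<alpha>\<^sup>2 - \<alpha> + 1)"
    using dvd_mult2[OF inv] by (simp only: dvd_add_right_iff)
  then have cube: "int p dvd \<alpha> + \<beta>\<^sup>2 \<longleftrightarrow> int p dvd \<alpha> + 1 \<or> int p dvd \<alpha>\<^sup>2 - \<alpha> + 1"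
    using not_dvd_residue[OF \<alpha>] by (simp add: prime_dvd_mult_int_iff[OF p] power2_eq_square)
  have "(2 * \<alpha> - 1)\<^sup>2 + 3 = 4 * (\<alpha>\<^sup>2 - \<alpha> + 1)"
    by (simp add: power2_eq_square algebra_simps)
  then have disc: "int p dvd (2 * \<alpha> - 1)\<^sup>2 + 3 \<longleftrightarrow> int p dvd \<alpha>\<^sup>2 - \<alpha> + 1"
    using prime_gt_3_not_dvd(3) by (simp only: prime_dvd_mult_int_iff[OF p] simp_thms)
  \<comment> \<open>The quadratic equals \<open>(\<alpha> + 1) * (\<alpha> - 2) + 3\<close>, so both
    factors vanish together only if \<open>p\<close> divides 3.\<close>
  have "\<not> int p dvd \<alpha>\<^sup>2 - \<alpha> + 1" if "int p dvd \<alpha> + 1"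
  proof
    assume "int p dvd \<alpha>\<^sup>2 - \<alpha> + 1"
    from dvd_diff[OF this dvd_mult2[OF that, of "\<alpha> - 2"]] show False using prime_gt_3_not_dvd(2) by (simp add: power2_eq_square algebra_simps)
  qed
  with cube disc minus_one show ?thesis by blast
qed

lemma cong_minus_3_square_iff: "[int p - 3 = k\<^sup>2] (mod int p) \<longleftrightarrow> int p dvd k\<^sup>2 + 3"
proof -
  have "int p - 3 - k\<^sup>2 = int p - (k\<^sup>2 + 3)" by simp
  then have "[int p - 3 = k\<^sup>2] (mod int p) \<longleftrightarrow> int p dvd int p - (k\<^sup>2 + 3)"
    by (simp only: cong_iff_dvd_diff)
  also have "\<dots> \<longleftrightarrow> int p dvd k\<^sup>2 + 3" by (rule dvd_diff_right_iff) simp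
  finally show ?thesis .
qed

lemma mem_M_ss_iff_discriminant:
  "(\<alpha>, \<beta>, d) \<in> M_ss p \<longleftrightarrow> (\<alpha>, \<beta>, d) \<in> M p \<and> d = 0 \<and> int p dvd \<alpha> * \<beta> - 1 \<and>
    int p dvd (2 * \<alpha> - 1)\<^sup>2 + 3"
  unfolding mem_M_ss_iff[OF p]
  using semi_symmetric_discriminant_iff[OF mem_M_units(1)[OF p]] by blast

text \<open>Converts the displayed field expressions into divisibility conditions that determine
  both residues. It serves both signs, with \<open>e\<close> taken as \<open>k\<close> and as
  \<open>- k\<close>.\<close>

lemma semi_symmetric_pair_iff:
  assumes e: "int p dvd e\<^sup>2 + 3" and range: "\<alpha> \<in> {0..<int p}" "\<beta> \<in> {0..<int p}"
  shows "\<alpha> = ((1 + e) mod int p) \<otimes>\<^bsub>Zmod p\<^esub> inv\<^bsub>Zmod p\<^esub> 2 \<and>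
      \<beta> = 2 \<otimes>\<^bsub>Zmod p\<^esub> inv\<^bsub>Zmod p\<^esub> ((1 + e) mod int p) \<longleftrightarrow>
    int p dvd 2 * \<alpha> - (1 + e) \<and> int p dvd \<alpha> * \<beta> - 1"
proof -
  define c where "c = (1 + e) mod int p"
  define A where "A = c * inv\<^bsub>Zmod p\<^esub> 2 mod int p"
  define B where "B = 2 * inv\<^bsub>Zmod p\<^esub> c mod int p"
  have p0: "int p > 0" using p3 by simp
  have c_dvd: "int p dvd c - (1 + e)" by (simp add: c_def mod_eq_dvd_iff[symmetric])
  \<comment> \<open>If \<open>e\<close> were -1 modulo \<open>p\<close>, then
    \<open>e\<^sup>2 + 3\<close> would be 4.\<close>
  have "\<not> int p dvd 1 + e"
  proof
    assume "int p dvd 1 + e"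
    from dvd_diff[OF e dvd_mult2[OF this, of "e - 1"]] show False using prime_gt_3_not_dvd(3) by (simp add: power2_eq_square algebra_simps)
  qed
  then have "c \<noteq> 0" by (simp add: c_def dvd_eq_mod_eq_0)
  moreover have "0 \<le> c" "c < int p" using p0 by (simp_all add: c_def)
  ultimately have c: "c \<in> {1..int p - 1}" by simp
  have two: "2 \<in> {1..int p - 1}" using p3 by simp
  note inv_c = Zmod_inv_inverse[OF p c] and inv_2 = Zmod_inv_inverse[OF p two]
  have A_dvd: "int p dvd A - c * inv\<^bsub>Zmod p\<^esub> 2" and B_dvd: "int p dvd B - 2 * inv\<^bsub>Zmod p\<^esub> c"
    by (simp_all add: A_def B_def mod_eq_dvd_iff[symmetric])
  have A_range: "0 \<le> A" "A < int p" and B_range: "0 \<le> B" "B < int p"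
    using p0 by (simp_all add: A_def B_def)
  have "2 * A - (1 + e) = 2 * (A - c * inv\<^bsub>Zmod p\<^esub> 2) + c * (2 * inv\<^bsub>Zmod p\<^esub> 2 - 1) + (c - (1 + e))"
    by (simp add: algebra_simps)
  also have "int p dvd \<dots>" by (intro dvd_add[OF dvd_add] dvd_mult A_dvd inv_2 c_dvd)
  finally have A: "int p dvd 2 * A - (1 + e)" .
  \<comment> \<open>The sum passes from \<open>2 * A * B\<close> through \<open>c * B\<close> and
    twice \<open>c\<close> times its inverse to 2; the factor 2 on the left is then
    cancelled.\<close>
  have "2 * (A * B - 1) = (2 * A - (1 + e)) * B - (c - (1 + e)) * B
      + c * (B - 2 * inv\<^bsub>Zmod p\<^esub> c) + 2 * (c * inv\<^bsub>Zmod p\<^esub> c - 1)"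
    by (simp add: algebra_simps)
  also have "int p dvd \<dots>"
    by (intro dvd_add[OF dvd_add[OF dvd_diff]] dvd_mult dvd_mult2[OF A] dvd_mult2[OF c_dvd] B_dvd inv_c)
  finally have AB: "int p dvd A * B - 1"
    using prime_gt_3_not_dvd(1) by (simp only: prime_dvd_mult_int_iff[OF p] simp_thms)
  have "\<alpha> = A \<and> \<beta> = B \<longleftrightarrow> int p dvd 2 * \<alpha> - (1 + e) \<and> int p dvd \<alpha> * \<beta> - 1"
  proof
    assume H: "int p dvd 2 * \<alpha> - (1 + e) \<and> int p dvd \<alpha> * \<beta> - 1"
    from dvd_diff[OF conjunct1[OF H] A] have "int p dvd 2 * (\<alpha> - A)" by (simp add: algebra_simps)
    then have "int p dvd \<alpha> - A"
      using prime_gt_3_not_dvd(1) by (simp only: prime_dvd_mult_int_iff[OF p] simp_thms)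
    then have \<alpha>: "\<alpha> = A" using range A_range by (intro residue_eqI) auto
    from dvd_diff[OF conjunct2[OF H] AB] have "int p dvd \<alpha> * (\<beta> - B)" by (simp add: \<alpha> algebra_simps)
    moreover have "\<not> int p dvd \<alpha>"
    proof
      assume "int p dvd \<alpha>"
      from dvd_diff[OF dvd_mult2[OF this, of \<beta>] conjunct2[OF H]] show False using p3 by simp
    qed
    ultimately have "int p dvd \<beta> - B" by (simp add: prime_dvd_mult_int_iff[OF p])
    then have "\<beta> = B" using range B_range by (intro residue_eqI) auto
    with \<alpha> show "\<alpha> = A \<and> \<beta> = B" ..
  qed (use A AB in simp)
  moreover have "A = ((1 + e) mod int p) \<otimes>\<^bsub>Zmod p\<^esub> inv\<^bsub>Zmod p\<^esub> 2"
    "B = 2 \<otimes>\<^bsub>Zmod p\<^esub> inv\<^bsub>Zmod p\<^esub> ((1 + e) mod int p)"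
    by (simp_all add: A_def B_def c_def residue_ring_def)
  ultimately show ?thesis by simp
qed

lemma M_ss_empty:
  assumes "\<not> QuadRes (int p) (int p - 3)"
  shows "M_ss p = {}"
proof -
  have "\<not> int p dvd k\<^sup>2 + 3" for k
    using assms cong_minus_3_square_iff[of k] by (auto simp: QuadRes_def cong_sym_eq)
  then have "(\<alpha>, \<beta>, d) \<notin> M_ss p" for \<alpha> \<beta> d by (simp add: mem_M_ss_iff_discriminant)
  then show ?thesis by auto
qed

text \<open>Since \<open>k\<close> squares to -3, the discriminant condition splits into
  \<open>2 * \<alpha> = 1 + k\<close> or \<open>2 * \<alpha> = 1 - k\<close> modulo
  \<open>p\<close>, and \<beta> is the inverse of \<alpha>.\<close>

lemma M_ss_eq:
  assumes "[int p - 3 = k\<^sup>2] (mod int p)"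
  shows "M_ss p =
    {(((1 + k) mod int p) \<otimes>\<^bsub>Zmod p\<^esub> inv\<^bsub>Zmod p\<^esub> 2,
      2 \<otimes>\<^bsub>Zmod p\<^esub> inv\<^bsub>Zmod p\<^esub> ((1 + k) mod int p), 0),
     (((1 - k) mod int p) \<otimes>\<^bsub>Zmod p\<^esub> inv\<^bsub>Zmod p\<^esub> 2,
      2 \<otimes>\<^bsub>Zmod p\<^esub> inv\<^bsub>Zmod p\<^esub> ((1 - k) mod int p), 0)}"
    (is "_ = {(?A, ?B, 0), (?A', ?B', 0)}")
proof -
  have k: "int p dvd k\<^sup>2 + 3" using assms cong_minus_3_square_iff by simp
  then have mk: "int p dvd (- k)\<^sup>2 + 3" by simp
  have p0: "int p > 0" using p3 by simp
  have bounds: "?A \<in> {0..<int p}" "?B \<in> {0..<int p}" "?A' \<in> {0..<int p}" "?B' \<in> {0..<int p}"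
    using p0 by (simp_all add: residue_ring_def)
  have "(\<alpha>, \<beta>, d) \<in> M_ss p \<longleftrightarrow> (\<alpha>, \<beta>, d) \<in> {(?A, ?B, 0), (?A', ?B', 0)}" for \<alpha> \<beta> d
  proof (cases "\<alpha> \<in> {0..<int p} \<and> \<beta> \<in> {0..<int p}")
    case True
    then have range: "\<alpha> \<in> {0..<int p}" "\<beta> \<in> {0..<int p}" by auto
    have units: "\<alpha> \<in> {1..int p - 1} \<and> \<beta> \<in> {1..int p - 1}" if "int p dvd \<alpha> * \<beta> - 1"
    proof -
      have "\<alpha> * \<beta> \<noteq> 0" using that p3 by auto
      then have "\<alpha> \<noteq> 0" "\<beta> \<noteq> 0" by simp_all
      with range show ?thesis by auto
    qed
    have "(2 * \<alpha> - 1)\<^sup>2 + 3 = (2 * \<alpha> - (1 + k)) * (2 * \<alpha> - (1 - k)) + (k\<^sup>2 + 3)"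
      by (simp add: power2_eq_square algebra_simps)
    then have "int p dvd (2 * \<alpha> - 1)\<^sup>2 + 3 \<longleftrightarrow>
        int p dvd (2 * \<alpha> - (1 + k)) * (2 * \<alpha> - (1 - k))"
      using k by (simp only: dvd_add_left_iff)
    then have "int p dvd (2 * \<alpha> - 1)\<^sup>2 + 3 \<longleftrightarrow>
        int p dvd 2 * \<alpha> - (1 + k) \<or> int p dvd 2 * \<alpha> - (1 - k)"
      by (simp only: prime_dvd_mult_int_iff[OF p])
    then have "(\<alpha>, \<beta>, d) \<in> M_ss p \<longleftrightarrow> d = 0 \<and>
        (int p dvd 2 * \<alpha> - (1 + k) \<and> int p dvd \<alpha> * \<beta> - 1 \<or>
         int p dvd 2 * \<alpha> - (1 - k) \<and> int p dvd \<alpha> * \<beta> - 1)"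
      using units by (auto simp: mem_M_ss_iff_discriminant mem_M_iff[OF p])
    also have "\<dots> \<longleftrightarrow> d = 0 \<and> (\<alpha> = ?A \<and> \<beta> = ?B \<or> \<alpha> = ?A' \<and> \<beta> = ?B')"
      using semi_symmetric_pair_iff[OF k range] semi_symmetric_pair_iff[OF mk range] by simp
    finally show ?thesis by auto
  next
    case False
    then have "(\<alpha>, \<beta>, d) \<notin> M p" by (auto simp: mem_M_iff[OF p])
    then have "(\<alpha>, \<beta>, d) \<notin> M_ss p" by (simp add: M_ss_def)
    with False bounds show ?thesis by auto
  qed
  then show ?thesis by auto
qed

section \<open>Explicit lists for the remaining classes\<close>

text \<open>As \<open>p\<close> is odd, (p + 1) / 2 is an integer and inverts 2. The form without
  division suits linear arithmetic.\<close>

lemma Zmod_inv_2: "2 * inv\<^bsub>Zmod p\<^esub> 2 = int p + 1"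
proof -
  have "odd p" using p p3 by (intro prime_odd_nat) auto
  then obtain n where n: "p = 2 * n + 1" by (rule oddE)
  have "inv\<^bsub>Zmod p\<^esub> 2 = int n + 1"
    by (rule Zmod_inv_eqI[OF p]) (use n p3 in auto)
  then show ?thesis using n by simp
qed

text \<open>On the diagonal the condition for \<open>d = 1\<close> reads
  \<open>2 * \<alpha> = int p + 1\<close>, hence the single extra triple.\<close>

lemma M_cs_eq: "M_cs p = {(\<alpha>, \<alpha>, 0) | \<alpha>. \<alpha> \<in> {1..int p - 2}} \<union>
    {(inv\<^bsub>Zmod p\<^esub> 2, inv\<^bsub>Zmod p\<^esub> 2, 1)}"
proof -
  have "(\<alpha>, \<beta>, d) \<in> M_cs p \<longleftrightarrow> (\<alpha> = \<beta> \<and> d = 0 \<and> \<alpha> \<in> {1..int p - 2}) \<or>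
      (\<alpha> = inv\<^bsub>Zmod p\<^esub> 2 \<and> \<beta> = inv\<^bsub>Zmod p\<^esub> 2 \<and> d = 1)" for \<alpha> \<beta> d
    using Zmod_inv_2 p3 unfolding mem_M_cs_iff[OF p] mem_M_iff[OF p] by auto
  then show ?thesis by auto
qed

text \<open>For \<open>d = 1\<close>, \<open>\<beta> = int p - 1\<close> leaves only \<alpha> = 2,
  which differs from \<open>int p - 1\<close> because \<open>p > 3\<close>.\<close>

lemma M_ls_eq: "M_ls p = {(\<alpha>, int p - 1, 0) | \<alpha>. \<alpha> \<in> {1..int p - 2}} \<union> {(2, int p - 1, 1)}"
proof -
  have "(\<alpha>, \<beta>, d) \<in> M_ls p \<longleftrightarrow> (\<beta> = int p - 1 \<and> d = 0 \<and> \<alpha> \<in> {1..int p - 2}) \<or>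
      (\<alpha> = 2 \<and> \<beta> = int p - 1 \<and> d = 1)" for \<alpha> \<beta> d
    using p3 unfolding mem_M_ls_iff[OF p] mem_M_iff[OF p] by auto
  then show ?thesis by auto
qed

lemma M_rs_eq: "M_rs p = {(int p - 1, \<beta>, 0) | \<beta>. \<beta> \<in> {1..int p - 2}} \<union> {(int p - 1, 2, 1)}"
proof -
  have "(\<alpha>, \<beta>, d) \<in> M_rs p \<longleftrightarrow> (\<alpha> = int p - 1 \<and> d = 0 \<and> \<beta> \<in> {1..int p - 2}) \<or>
      (\<alpha> = int p - 1 \<and> \<beta> = 2 \<and> d = 1)" for \<alpha> \<beta> d
    using p3 unfolding mem_M_rs_iff[OF p] mem_M_iff[OF p] by auto
  then show ?thesis by auto
qed

text \<open>The case \<open>d = 1\<close> would require 2 (p - 1) = p + 1, that is p = 3.\<close>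

lemma M_ts_eq: "M_ts p = {(int p - 1, int p - 1, 0)}"
proof -
  have "(\<alpha>, \<beta>, d) \<in> M_ts p \<longleftrightarrow> \<alpha> = int p - 1 \<and> \<beta> = int p - 1 \<and> d = 0" for \<alpha> \<beta> d
    using p3 unfolding mem_M_ts_iff[OF p] mem_M_iff[OF p] by auto
  then show ?thesis by auto
qed

text \<open>For \<open>d = 1\<close> the value \<alpha> = 2 is the left symmetric one,
  \<open>int p - 1\<close> the right symmetric one, and the inverse of 2 the commutative one, since
  1 minus that inverse is again that inverse. Semi-symmetry removes triples only where
  \<open>d = 0\<close>.\<close>

lemma M_as_eq: "M_as p =
    ({(\<alpha>, 1 \<ominus>\<^bsub>Zmod p\<^esub> \<alpha>, 1) | \<alpha>. \<alpha> \<in> {3..int p - 2}} -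
      {(inv\<^bsub>Zmod p\<^esub> 2, 1 \<ominus>\<^bsub>Zmod p\<^esub> inv\<^bsub>Zmod p\<^esub> 2, 1)}) \<union>
    ({(\<alpha>, \<beta>, 0) | \<alpha> \<beta>. \<alpha> \<in> {1..int p - 2} \<and> \<beta> \<in> {1..int p - 2} \<and> \<alpha> \<noteq> \<beta>} - M_ss p)"
proof -
  let ?h = "inv\<^bsub>Zmod p\<^esub> 2"
  have "(\<alpha>, 1 \<ominus>\<^bsub>Zmod p\<^esub> \<alpha>, 1) = (\<alpha>, int p + 1 - \<alpha>, 1 :: int)" if "\<alpha> \<in> {3..int p - 2}" for \<alpha>
    using that Zmod_one_minus[OF p, of \<alpha>] by simp
  then have 1: "{(\<alpha>, 1 \<ominus>\<^bsub>Zmod p\<^esub> \<alpha>, 1 :: int) | \<alpha>. \<alpha> \<in> {3..int p - 2}} =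
      {(\<alpha>, int p + 1 - \<alpha>, 1) | \<alpha>. \<alpha> \<in> {3..int p - 2}}"
    by (metis (lifting))
  have h: "2 * ?h = int p + 1" by (rule Zmod_inv_2)
  then have 2: "1 \<ominus>\<^bsub>Zmod p\<^esub> ?h = ?h"
    using p3 Zmod_one_minus[OF p, of ?h] by simp
  have not_ss: "(\<alpha>, \<beta>, d) \<notin> M_ss p" if "d \<noteq> 0" for \<alpha> \<beta> d
    using that by (simp add: mem_M_ss_iff[OF p])
  have "(\<alpha>, \<beta>, d) \<in> M_as p \<longleftrightarrow>
      (d = 1 \<and> \<beta> = int p + 1 - \<alpha> \<and> \<alpha> \<in> {3..int p - 2} \<and> \<alpha> \<noteq> ?h) \<or>
      (d = 0 \<and> \<alpha> \<in> {1..int p - 2} \<and> \<beta> \<in> {1..int p - 2} \<and> \<alpha> \<noteq> \<beta> \<and> (\<alpha>, \<beta>, d) \<notin> M_ss p)"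
    for \<alpha> \<beta> d
    using h p3 not_ss[of d \<alpha> \<beta>] unfolding mem_M_as_iff[OF p] mem_M_iff[OF p] by auto
  then show ?thesis unfolding 1 2 using h by auto
qed

end

section \<open>The partition of \<open>M\<close>\<close>

text \<open>By \<open>mem_M_as_iff\<close> the asymmetric triples are those left over after the
  conditions on \<alpha> and \<beta> and after \<open>M_ss\<close>, so covering is a propositional
  case split.\<close>

lemma M_eq_Un:
  assumes p: "prime p"
  shows "M p = M_cs p \<union> M_ls p \<union> M_rs p \<union> M_ts p \<union> M_ss p \<union> M_as p"
proof -
  have "(\<alpha>, \<beta>, d) \<in> M p \<longleftrightarrow> (\<alpha>, \<beta>, d) \<in> M_cs p \<union> M_ls p \<union> M_rs p \<union> M_ts p \<union> M_ss p \<union> M_as p"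
    for \<alpha> \<beta> d
    unfolding Un_iff mem_M_cs_iff[OF p] mem_M_ls_iff[OF p] mem_M_rs_iff[OF p] mem_M_ts_iff[OF p]
      mem_M_as_iff[OF p]
    using M_ss_def[of p] by blast
  then show ?thesis by auto
qed

lemma disjoint_family_on_M:
  assumes p: "prime p"
  shows "disjoint_family_on (\<lambda>i. [M_cs p, M_ls p, M_rs p, M_ts p, M_ss p, M_as p] ! i) {..<6}"
proof -
  \<comment> \<open>Equality of \<alpha> and \<beta> would turn the vanishing of
    \<open>\<alpha> + \<beta>\<^sup>2\<close> into that of \<open>\<alpha> * (\<alpha> + 1)\<close>,
    forcing the excluded value -1.\<close>
  have ss: "\<alpha> \<noteq> \<beta> \<and> \<alpha> \<noteq> int p - 1 \<and> \<beta> \<noteq> int p - 1" if "(\<alpha>, \<beta>, d) \<in> M_ss p" for \<alpha> \<beta> d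
  proof -
    from that have H: "(\<alpha>, \<beta>, d) \<in> M p" "int p dvd \<alpha> * \<beta> - 1" "int p dvd \<alpha> + \<beta>\<^sup>2"
      "\<alpha> \<noteq> int p - 1" using mem_M_ss_iff[OF p, of \<alpha> \<beta> d] by blast+
    note ab = mem_M_units[OF p H(1)]
    have "\<alpha> \<noteq> \<beta>"
    proof
      assume "\<alpha> = \<beta>"
      with H(3) have "int p dvd \<alpha> * (\<alpha> + 1)" by (simp add: power2_eq_square algebra_simps)
      then have "int p dvd \<alpha> + 1"
        using not_dvd_residue[OF ab(1)] by (simp add: prime_dvd_mult_int_iff[OF p])
      with H(4) ab residue_eq_minus_one_iff[of \<alpha> "int p"] show False by simp
    qed
    with H semi_symmetric_minus_one_iff[OF p ab H(2)] show ?thesis by simp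
  qed
  \<comment> \<open>A function giving the index of the only class that can contain a triple settles
    all pairs of classes at once.\<close>
  define kind :: "triple \<Rightarrow> nat" where "kind = (\<lambda>(\<alpha>, \<beta>, d).
    if \<alpha> = \<beta> then if \<alpha> = int p - 1 then 3 else 0
    else if \<beta> = int p - 1 then 1 else if \<alpha> = int p - 1 then 2
    else if (\<alpha>, \<beta>, d) \<in> M_ss p then 4 else 5)"
  have kind: "kind t = i" if "i < 6" "t \<in> [M_cs p, M_ls p, M_rs p, M_ts p, M_ss p, M_as p] ! i"
    for i t
  proof -
    obtain \<alpha> \<beta> d where t: "t = (\<alpha>, \<beta>, d)" by (cases t)
    have "(\<alpha>, \<beta>, d) \<in> M_cs p \<Longrightarrow> kind t = 0" "(\<alpha>, \<beta>, d) \<in> M_ls p \<Longrightarrow> kind t = 1"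
      "(\<alpha>, \<beta>, d) \<in> M_rs p \<Longrightarrow> kind t = 2" "(\<alpha>, \<beta>, d) \<in> M_ts p \<Longrightarrow> kind t = 3"
      "(\<alpha>, \<beta>, d) \<in> M_as p \<Longrightarrow> kind t = 5"
      unfolding kind_def t mem_M_cs_iff[OF p] mem_M_ls_iff[OF p] mem_M_rs_iff[OF p]
        mem_M_ts_iff[OF p] mem_M_as_iff[OF p] by simp_all
    moreover have "(\<alpha>, \<beta>, d) \<in> M_ss p \<Longrightarrow> kind t = 4"
      using ss[of \<alpha> \<beta> d] by (simp add: kind_def t)
    moreover have "i = 0 \<or> i = 1 \<or> i = 2 \<or> i = 3 \<or> i = 4 \<or> i = 5" using that(1) by presburger
    ultimately show ?thesis using that(2) unfolding t by (elim disjE) simp_all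
  qed
  show ?thesis
    unfolding disjoint_family_on_def using kind by (metis disjoint_iff lessThan_iff)
qed

theorem theorem21:
  fixes p :: nat
  assumes "prime p" and "p > 3"
  shows
    "(\<forall>t\<in>M p. linear_group_isotope (isotope p t) \<and> card (carrier (isotope p t)) = p) \<and>
     (\<forall>s\<in>M p. \<forall>t\<in>M p. magma_isomorphic (isotope p s) (isotope p t) \<longrightarrow> s = t) \<and>
     (\<forall>Q :: 'a magma. linear_group_isotope Q \<and> card (carrier Q) = p \<longrightarrow>
        (\<exists>!t. t \<in> M p \<and> magma_isomorphic Q (isotope p t))) \<and>
     M p = M_cs p \<union> M_ls p \<union> M_rs p \<union> M_ts p \<union> M_ss p \<union> M_as p \<and>
     disjoint_family_on (\<lambda>i. [M_cs p, M_ls p, M_rs p, M_ts p, M_ss p, M_as p] ! i) {..<6} \<and>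
     M_cs p = {(\<alpha>, \<alpha>, 0) | \<alpha>. \<alpha> \<in> {1..int p - 2}} \<union>
              {(inv\<^bsub>Zmod p\<^esub> 2, inv\<^bsub>Zmod p\<^esub> 2, 1)} \<and>
     M_ls p = {(\<alpha>, int p - 1, 0) | \<alpha>. \<alpha> \<in> {1..int p - 2}} \<union> {(2, int p - 1, 1)} \<and>
     M_rs p = {(int p - 1, \<beta>, 0) | \<beta>. \<beta> \<in> {1..int p - 2}} \<union> {(int p - 1, 2, 1)} \<and>
     M_ts p = {(int p - 1, int p - 1, 0)} \<and>
     (\<not> QuadRes (int p) (int p - 3) \<longrightarrow> M_ss p = {}) \<and>
     (\<forall>k :: int. [int p - 3 = k ^ 2] (mod int p) \<longrightarrow>
        M_ss p =
          {(((1 + k) mod int p) \<otimes>\<^bsub>Zmod p\<^esub> inv\<^bsub>Zmod p\<^esub> 2,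
            2 \<otimes>\<^bsub>Zmod p\<^esub> inv\<^bsub>Zmod p\<^esub> ((1 + k) mod int p), 0),
           (((1 - k) mod int p) \<otimes>\<^bsub>Zmod p\<^esub> inv\<^bsub>Zmod p\<^esub> 2,
            2 \<otimes>\<^bsub>Zmod p\<^esub> inv\<^bsub>Zmod p\<^esub> ((1 - k) mod int p), 0)}) \<and>
     M_as p =
       ({(\<alpha>, 1 \<ominus>\<^bsub>Zmod p\<^esub> \<alpha>, 1) | \<alpha>. \<alpha> \<in> {3..int p - 2}} -
          {(inv\<^bsub>Zmod p\<^esub> 2, 1 \<ominus>\<^bsub>Zmod p\<^esub> inv\<^bsub>Zmod p\<^esub> 2, 1)}) \<union>
       ({(\<alpha>, \<beta>, 0) | \<alpha> \<beta>. \<alpha> \<in> {1..int p - 2} \<and> \<beta> \<in> {1..int p - 2} \<and> \<alpha> \<noteq> \<beta>} - M_ss p)"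
proof (intro conjI ballI allI impI)
  fix t assume "t \<in> M p"
  then obtain \<alpha> \<beta> d where t: "t = (\<alpha>, \<beta>, d)" and ab: "\<alpha> \<in> {1..int p - 1}" "\<beta> \<in> {1..int p - 1}"
    and d: "d \<in> {0..<int p}" by (rule mem_M_cases[OF assms(1)])
  show "linear_group_isotope (isotope p t)"
    unfolding t by (rule isotope_linear_group_isotope[OF assms(1) not_dvd_residue[OF ab(1)]
      not_dvd_residue[OF ab(2)] d])
  show "card (carrier (isotope p t)) = p" by (simp add: t carrier_isotope)
next
  fix s t assume "s \<in> M p" "t \<in> M p" "magma_isomorphic (isotope p s) (isotope p t)"
  then show "s = t" by (rule isotope_isomorphic_imp_eq[OF assms(1)])
next
  fix Q :: "'a magma" assume "linear_group_isotope Q \<and> card (carrier Q) = p"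
  then show "\<exists>!t. t \<in> M p \<and> magma_isomorphic Q (isotope p t)"
    using linear_group_isotope_classification[OF assms(1)] by blast
next
  show "M p = M_cs p \<union> M_ls p \<union> M_rs p \<union> M_ts p \<union> M_ss p \<union> M_as p"
    by (rule M_eq_Un[OF assms(1)])
  show "disjoint_family_on (\<lambda>i. [M_cs p, M_ls p, M_rs p, M_ts p, M_ss p, M_as p] ! i) {..<6}"
    by (rule disjoint_family_on_M[OF assms(1)])
qed (fact M_cs_eq[OF assms] M_ls_eq[OF assms] M_rs_eq[OF assms] M_ts_eq[OF assms]
  M_as_eq[OF assms] | rule M_ss_empty[OF assms] M_ss_eq[OF assms], assumption)+

end
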